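(* Let $p$ be a prime number. For integers $m>n\geq 1$, let \[\phi(z)=\frac{z^{p}-z}{p+z^{p^{m}}-z^{p^{n}}}\in\mathbb{Q}_p(z).\] Then the dynamical system $(\mathbb{P}^1(\mathbb{Q}_p),\phi)$ has empty Fatou set.
   Context: $\mathbb{Q}_p$ is the field of $p$-adic numbers with its absolute value $|\cdot|_p$. The projective line $\mathbb{P}^1(\mathbb{Q}_p)$ is equipped with the spherical metric: for $P=[x_1,y_1]$, $Q=[x_2,y_2]\in\mathbb{P}^1(\mathbb{Q}_p)$, \[\rho(P,Q)=\frac{|x_1y_2-x_2y_1|_p}{\max\{|x_1|_p,|y_1|_p\}\,\max\{|x_2|_p,|y_2|_p\}}.\] A rational map $\phi\in \mathbb{Q}_p(z)$ induces a continuous map $\phi:\mathbb{P}^1(\mathbb{Q}_p)\to\mathbb{P}^1(\mathbb{Q}_p)$. The Fatou set of the system $(\mathbb{P}^1(\mathbb{Q}_p),\phi)$ is the set of points of $\mathbb{P}^1(\mathbb{Q}_p)$ having a neighborhood (in $\mathbb{P}^1(\mathbb{Q}_p)$) on which the family of iterates $\{\phi^k\}_{k\ge 0}$ is equicontinuous with respect to $\rho$. *)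

theory Defs
  imports
    Complex_Main
    "HOL-Computational_Algebra.Computational_Algebra"
    "HOL-Computational_Algebra.Field_as_Ring"
    "Berlekamp_Zassenhaus.Finite_Field"
begin

hide_const (open) up_ring.coeff up_ring.monom

section \<open>The \<open>p\<close>-adic absolute value on the rationals\<close>

definition int_pabs :: "nat \<Rightarrow> int \<Rightarrow> real" where
  "int_pabs p a = (if a = 0 then 0 else inverse (real p ^ multiplicity (int p) a))"

definition rat_pabs :: "nat \<Rightarrow> rat \<Rightarrow> real" where
  "rat_pabs p q = int_pabs p (fst (quotient_of q)) / int_pabs p (snd (quotient_of q))"

context
  fixes p :: nat
  assumes p: "prime p"
begin

lemma int_pabs_eq_0_iff: "int_pabs p a = 0 \<longleftrightarrow> a = 0"
  using p by (auto simp: int_pabs_def)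

lemma int_pabs_nonneg: "int_pabs p a \<ge> 0"
  by (auto simp: int_pabs_def)

lemma int_pabs_mult: "int_pabs p (a * b) = int_pabs p a * int_pabs p b"
  using p by (auto simp: int_pabs_def prime_elem_multiplicity_mult_distrib power_add)

lemma int_pabs_add: "int_pabs p (a + b) \<le> max (int_pabs p a) (int_pabs p b)"
proof (cases "a = 0 \<or> b = 0 \<or> a + b = 0")
  case True
  then show ?thesis using int_pabs_nonneg by (auto simp: int_pabs_def le_max_iff_disj)
next
  case False
  let ?m = "min (multiplicity (int p) a) (multiplicity (int p) b)"
  have "int p ^ ?m dvd a" "int p ^ ?m dvd b"
    by (auto intro: multiplicity_dvd')
  then have "int p ^ ?m dvd a + b" by simp
  then have le: "?m \<le> multiplicity (int p) (a + b)"
    using p False by (intro multiplicity_geI) auto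
  have p1: "real p \<ge> 1" using p prime_ge_1_nat by force
  have "inverse (real p ^ multiplicity (int p) (a + b)) \<le> inverse (real p ^ ?m)"
    using p1 le by (intro le_imp_inverse_le power_increasing) auto
  then show ?thesis
    using False by (auto simp: int_pabs_def min_def le_max_iff_disj split: if_splits)
qed

lemma rat_pabs_Fract:
  assumes "b \<noteq> 0"
  shows "rat_pabs p (of_int a / of_int b) = int_pabs p a / int_pabs p b"
proof -
  obtain c d where cd: "quotient_of (of_int a / of_int b) = (c, d)" by force
  have d: "d > 0" using quotient_of_denom_pos[OF cd] .
  have "(of_int a / of_int b :: rat) = of_int c / of_int d"
    using quotient_of_div[OF cd] .
  then have "(of_int (a * d) :: rat) = of_int (c * b)"
    using assms d by (simp add: field_simps)
  then have "a * d = c * b" by (simp only: of_int_eq_iff)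
  then have "int_pabs p a * int_pabs p d = int_pabs p c * int_pabs p b"
    by (metis int_pabs_mult)
  then show ?thesis
    using assms d int_pabs_eq_0_iff[of b] int_pabs_eq_0_iff[of d]
    by (simp add: rat_pabs_def cd field_simps)
qed

lemma rat_as_quot:
  obtains a b :: int where "(q::rat) = of_int a / of_int b" "b \<noteq> 0"
proof -
  obtain c d where cd: "quotient_of q = (c, d)" by force
  then show ?thesis
    using quotient_of_div[OF cd] quotient_of_denom_pos[OF cd] that[of c d] by auto
qed

lemma rat_pabs_nonneg: "rat_pabs p q \<ge> 0"
  by (simp add: rat_pabs_def int_pabs_nonneg)

lemma rat_pabs_eq_0_iff: "rat_pabs p q = 0 \<longleftrightarrow> q = 0"
proof -
  obtain a b where "q = of_int a / of_int b" "b \<noteq> 0" by (rule rat_as_quot)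
  then show ?thesis by (simp add: rat_pabs_Fract int_pabs_eq_0_iff)
qed

lemma rat_pabs_mult: "rat_pabs p (q * r) = rat_pabs p q * rat_pabs p r"
proof -
  obtain a b where q: "q = of_int a / of_int b" "b \<noteq> 0" by (rule rat_as_quot)
  obtain c d where r: "r = of_int c / of_int d" "d \<noteq> 0" by (rule rat_as_quot)
  have "q * r = of_int (a * c) / of_int (b * d)" using q r by simp
  then have "rat_pabs p (q * r) = int_pabs p (a * c) / int_pabs p (b * d)"
    using q r by (metis rat_pabs_Fract mult_eq_0_iff)
  then show ?thesis using q r by (simp add: rat_pabs_Fract int_pabs_mult)
qed

lemma rat_pabs_add: "rat_pabs p (q + r) \<le> max (rat_pabs p q) (rat_pabs p r)"
proof -
  obtain a b where q: "q = of_int a / of_int b" "b \<noteq> 0" by (rule rat_as_quot)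
  obtain c d where r: "r = of_int c / of_int d" "d \<noteq> 0" by (rule rat_as_quot)
  have pos: "int_pabs p b > 0" "int_pabs p d > 0"
    using q r int_pabs_nonneg int_pabs_eq_0_iff by (auto simp: less_le)
  have "q + r = of_int (a * d + c * b) / of_int (b * d)"
    using q r by (simp add: field_simps)
  then have "rat_pabs p (q + r) = int_pabs p (a * d + c * b) / int_pabs p (b * d)"
    using q r by (metis rat_pabs_Fract mult_eq_0_iff)
  also have "\<dots> \<le> max (int_pabs p (a * d)) (int_pabs p (c * b)) / int_pabs p (b * d)"
    by (intro divide_right_mono int_pabs_add int_pabs_nonneg)
  also have "\<dots> = max (int_pabs p a / int_pabs p b) (int_pabs p c / int_pabs p d)"
    using pos by (auto simp: int_pabs_mult max_def field_simps)
  also have "\<dots> = max (rat_pabs p q) (rat_pabs p r)"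
    using q r by (simp add: rat_pabs_Fract)
  finally show ?thesis .
qed

lemma rat_pabs_0: "rat_pabs p 0 = 0"
  by (simp add: rat_pabs_eq_0_iff)

lemma rat_pabs_1: "rat_pabs p 1 = 1"
  using rat_pabs_mult[of 1 1] rat_pabs_eq_0_iff[of 1] by auto

lemma rat_pabs_minus: "rat_pabs p (- q) = rat_pabs p q"
proof -
  have "rat_pabs p (-1) * rat_pabs p (-1) = 1"
    using rat_pabs_mult[of "-1" "-1"] rat_pabs_1 by simp
  then have "rat_pabs p (-1) = 1"
    using rat_pabs_nonneg[of "-1"] by (metis abs_of_nonneg abs_1 abs_square_eq_1 power2_eq_square)
  then show ?thesis using rat_pabs_mult[of "-1" q] by simp
qed

lemma rat_pabs_triangle: "rat_pabs p (q + r) \<le> rat_pabs p q + rat_pabs p r"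
  using rat_pabs_add[of q r] rat_pabs_nonneg[of q] rat_pabs_nonneg[of r] by linarith

lemma rat_pabs_diff_commute: "rat_pabs p (q - r) = rat_pabs p (r - q)"
  using rat_pabs_minus[of "q - r"] by simp

lemma rat_pabs_abs_diff: "\<bar>rat_pabs p q - rat_pabs p r\<bar> \<le> rat_pabs p (q - r)"
  using rat_pabs_triangle[of "q - r" r] rat_pabs_triangle[of "r - q" q]
    rat_pabs_diff_commute[of q r] by simp

lemma rat_pabs_inverse: "rat_pabs p (inverse q) = inverse (rat_pabs p q)"
proof (cases "q = 0")
  case True
  then show ?thesis by (simp add: rat_pabs_0)
next
  case False
  then have "rat_pabs p q * rat_pabs p (inverse q) = 1"
    using rat_pabs_mult[of q "inverse q"] rat_pabs_1 by simp
  then show ?thesis by (metis inverse_unique)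
qed

end


section \<open>\<open>p\<close>-adic Cauchy sequences of rationals\<close>

definition pcauchy :: "nat \<Rightarrow> (nat \<Rightarrow> rat) \<Rightarrow> bool" where
  "pcauchy p X \<longleftrightarrow> (\<forall>e>0. \<exists>K. \<forall>i\<ge>K. \<forall>j\<ge>K. rat_pabs p (X i - X j) < e)"

definition pnull :: "nat \<Rightarrow> (nat \<Rightarrow> rat) \<Rightarrow> bool" where
  "pnull p X \<longleftrightarrow> (\<lambda>i. rat_pabs p (X i)) \<longlonglongrightarrow> 0"

context
  fixes p :: nat
  assumes p: "prime p"
begin

lemma pcauchy_const: "pcauchy p (\<lambda>_. q)"
  by (simp add: pcauchy_def rat_pabs_0[OF p])

lemma pcauchy_add:
  assumes "pcauchy p X" "pcauchy p Y"
  shows "pcauchy p (\<lambda>i. X i + Y i)"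
  unfolding pcauchy_def
proof (intro allI impI)
  fix e :: real assume e: "e > 0"
  obtain K L where K: "\<forall>i\<ge>K. \<forall>j\<ge>K. rat_pabs p (X i - X j) < e"
    and L: "\<forall>i\<ge>L. \<forall>j\<ge>L. rat_pabs p (Y i - Y j) < e"
    using assms e unfolding pcauchy_def by meson
  have "rat_pabs p (X i + Y i - (X j + Y j)) < e" if "i \<ge> max K L" "j \<ge> max K L" for i j
  proof -
    have "rat_pabs p ((X i - X j) + (Y i - Y j)) < e"
      using K L that rat_pabs_add[OF p, of "X i - X j" "Y i - Y j"]
      by (metis le_less_trans max.boundedE max_less_iff_conj)
    then show ?thesis by (simp add: algebra_simps)
  qed
  then show "\<exists>K. \<forall>i\<ge>K. \<forall>j\<ge>K. rat_pabs p (X i + Y i - (X j + Y j)) < e" by blast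
qed

lemma pcauchy_minus: "pcauchy p X \<Longrightarrow> pcauchy p (\<lambda>i. - X i)"
  by (simp add: pcauchy_def rat_pabs_diff_commute[OF p] minus_diff_commute)

lemma pcauchy_convergent:
  assumes "pcauchy p X"
  shows "convergent (\<lambda>i. rat_pabs p (X i))"
proof -
  have "Cauchy (\<lambda>i. rat_pabs p (X i))"
  proof (rule CauchyI)
    fix e :: real assume "e > 0"
    then obtain K where "\<forall>i\<ge>K. \<forall>j\<ge>K. rat_pabs p (X i - X j) < e"
      using assms unfolding pcauchy_def by meson
    then show "\<exists>M. \<forall>m\<ge>M. \<forall>n\<ge>M. norm (rat_pabs p (X m) - rat_pabs p (X n)) < e"
      using rat_pabs_abs_diff[OF p] by (metis le_less_trans real_norm_def)
  qed
  then show ?thesis by (simp add: Cauchy_convergent_iff)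
qed

lemma pcauchy_bounded:
  assumes "pcauchy p X"
  obtains B where "B > 0" "\<And>i. rat_pabs p (X i) \<le> B"
proof -
  have "Bseq (\<lambda>i. rat_pabs p (X i))"
    using pcauchy_convergent[OF assms] by (rule convergent_imp_Bseq)
  then show ?thesis using that unfolding Bseq_def by (metis abs_le_D1 real_norm_def)
qed

lemma pcauchy_mult:
  assumes X: "pcauchy p X" and Y: "pcauchy p Y"
  shows "pcauchy p (\<lambda>i. X i * Y i)"
  unfolding pcauchy_def
proof (intro allI impI)
  fix e :: real assume e: "e > 0"
  obtain B where B: "B > 0" "\<And>i. rat_pabs p (X i) \<le> B" using pcauchy_bounded[OF X] by blast
  obtain C where C: "C > 0" "\<And>i. rat_pabs p (Y i) \<le> C" using pcauchy_bounded[OF Y] by blast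
  obtain K where K: "\<forall>i\<ge>K. \<forall>j\<ge>K. rat_pabs p (X i - X j) < e / (2 * C)"
    using X e C unfolding pcauchy_def by (meson divide_pos_pos mult_pos_pos zero_less_numeral)
  obtain L where L: "\<forall>i\<ge>L. \<forall>j\<ge>L. rat_pabs p (Y i - Y j) < e / (2 * B)"
    using Y e B unfolding pcauchy_def by (meson divide_pos_pos mult_pos_pos zero_less_numeral)
  have "rat_pabs p (X i * Y i - X j * Y j) < e" if ij: "i \<ge> max K L" "j \<ge> max K L" for i j
  proof -
    have "X i * Y i - X j * Y j = X i * (Y i - Y j) + (X i - X j) * Y j"
      by (simp add: algebra_simps)
    then have "rat_pabs p (X i * Y i - X j * Y j)
        \<le> rat_pabs p (X i) * rat_pabs p (Y i - Y j) + rat_pabs p (X i - X j) * rat_pabs p (Y j)"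
      using rat_pabs_triangle[OF p] by (metis rat_pabs_mult[OF p])
    also have "\<dots> \<le> B * rat_pabs p (Y i - Y j) + rat_pabs p (X i - X j) * C"
      by (intro add_mono mult_left_mono mult_right_mono B C rat_pabs_nonneg[OF p])
    also have "\<dots> < B * (e / (2 * B)) + e / (2 * C) * C"
      using K L ij B C by (intro add_strict_mono mult_strict_left_mono mult_strict_right_mono) auto
    also have "\<dots> = e" using B C by simp
    finally show ?thesis .
  qed
  then show "\<exists>K. \<forall>i\<ge>K. \<forall>j\<ge>K. rat_pabs p (X i * Y i - X j * Y j) < e" by blast
qed

lemma pcauchy_bounded_below:
  assumes X: "pcauchy p X" and "\<not> pnull p X"
  obtains c K where "c > 0" "\<And>i. i \<ge> K \<Longrightarrow> rat_pabs p (X i) > c"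
proof -
  obtain l where l: "(\<lambda>i. rat_pabs p (X i)) \<longlonglongrightarrow> l"
    using pcauchy_convergent[OF X] by (auto simp: convergent_def)
  then have "l \<ge> 0" by (rule LIMSEQ_le_const) (auto simp: rat_pabs_nonneg[OF p])
  moreover have "l \<noteq> 0" using l assms by (auto simp: pnull_def)
  ultimately have "l > 0" by simp
  then have "\<forall>\<^sub>F i in sequentially. rat_pabs p (X i) > l / 2"
    using l by (intro order_tendstoD) auto
  then show ?thesis using that[of "l / 2"] \<open>l > 0\<close> by (auto simp: eventually_sequentially)
qed

lemma pcauchy_inverse:
  assumes X: "pcauchy p X" and "\<not> pnull p X"
  shows "pcauchy p (\<lambda>i. inverse (X i))"
  unfolding pcauchy_def
proof (intro allI impI)
  fix e :: real assume e: "e > 0"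
  obtain c K where c: "c > 0" "\<And>i. i \<ge> K \<Longrightarrow> rat_pabs p (X i) > c"
    using pcauchy_bounded_below[OF assms] by blast
  obtain L where L: "\<forall>i\<ge>L. \<forall>j\<ge>L. rat_pabs p (X i - X j) < e * (c * c)"
    using X e c unfolding pcauchy_def by (meson mult_pos_pos)
  have "rat_pabs p (inverse (X i) - inverse (X j)) < e"
    if ij: "i \<ge> max K L" "j \<ge> max K L" for i j
  proof -
    have gt: "rat_pabs p (X i) > c" "rat_pabs p (X j) > c" using c ij by auto
    then have nz: "X i \<noteq> 0" "X j \<noteq> 0" using c rat_pabs_0[OF p] by auto
    have gt2: "c * c < rat_pabs p (X i) * rat_pabs p (X j)"
      using gt c by (intro mult_strict_mono) auto
    have eq: "inverse (X i) - inverse (X j) = (X j - X i) * (inverse (X i) * inverse (X j))"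
      using nz by (simp add: field_simps)
    have "rat_pabs p (inverse (X i) - inverse (X j))
        = rat_pabs p (X i - X j) / (rat_pabs p (X i) * rat_pabs p (X j))"
      unfolding eq rat_pabs_mult[OF p] rat_pabs_inverse[OF p] rat_pabs_diff_commute[OF p, of "X j"]
      by (simp add: divide_inverse)
    also have "\<dots> \<le> rat_pabs p (X i - X j) / (c * c)"
    proof (rule divide_left_mono)
      have "0 < c * c" using c(1) by simp
      then show "0 < rat_pabs p (X i) * rat_pabs p (X j) * (c * c)"
        using gt2 by (smt (verit) mult_pos_pos)
    qed (use gt2 rat_pabs_nonneg[OF p] in auto)
    also have "\<dots> < e" using L ij c by (simp add: divide_less_eq)
    finally show ?thesis .
  qed
  then show "\<exists>K. \<forall>i\<ge>K. \<forall>j\<ge>K. rat_pabs p (inverse (X i) - inverse (X j)) < e" by blast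
qed

lemma pnull_le:
  assumes "pnull p X" "\<And>i. rat_pabs p (Y i) \<le> B * rat_pabs p (X i)"
  shows "pnull p Y"
  using assms(1) unfolding pnull_def
  by (rule tendsto_0_le[where K = B])
    (use assms(2) in \<open>simp add: rat_pabs_nonneg[OF p] mult.commute\<close>)

lemma pnull_0: "pnull p (\<lambda>_. 0)"
  by (simp add: pnull_def rat_pabs_0[OF p])

lemma pnull_minus: "pnull p X \<Longrightarrow> pnull p (\<lambda>i. - X i)"
  by (simp add: pnull_def rat_pabs_minus[OF p])

lemma pnull_diff_commute: "pnull p (\<lambda>i. X i - Y i) \<Longrightarrow> pnull p (\<lambda>i. Y i - X i)"
  using pnull_minus[of "\<lambda>i. X i - Y i"] by simp

lemma pnull_add:
  assumes "pnull p X" "pnull p Y"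
  shows "pnull p (\<lambda>i. X i + Y i)"
proof -
  have "(\<lambda>i. rat_pabs p (X i) + rat_pabs p (Y i)) \<longlonglongrightarrow> 0"
    using tendsto_add[OF assms[unfolded pnull_def]] by simp
  then show ?thesis
    unfolding pnull_def
    by (rule tendsto_0_le[where K = 1])
      (simp add: rat_pabs_nonneg[OF p] rat_pabs_triangle[OF p] abs_of_nonneg)
qed

lemma pnull_mult:
  assumes "pcauchy p X" "pnull p Y"
  shows "pnull p (\<lambda>i. X i * Y i)"
proof -
  obtain B where B: "B > 0" "\<And>i. rat_pabs p (X i) \<le> B" using pcauchy_bounded[OF assms(1)] by blast
  show ?thesis
    using assms(2) by (rule pnull_le[where B = B])
      (auto simp: rat_pabs_mult[OF p] intro!: mult_right_mono B rat_pabs_nonneg[OF p])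
qed

lemma pnull_cong:
  assumes "pnull p (\<lambda>i. X i - Y i)"
  shows "pnull p X \<longleftrightarrow> pnull p Y"
  using pnull_add[OF assms, of Y] pnull_add[OF pnull_diff_commute[OF assms], of X] by auto

lemma pnull_mult_inverse:
  assumes "pcauchy p X" "\<not> pnull p X"
  shows "pnull p (\<lambda>i. inverse (X i) * X i - 1)"
proof -
  obtain c K where c: "c > 0" "\<And>i. i \<ge> K \<Longrightarrow> rat_pabs p (X i) > c"
    using pcauchy_bounded_below[OF assms] by blast
  have "rat_pabs p (inverse (X i) * X i - 1) = 0" if "i \<ge> K" for i
  proof -
    have "X i \<noteq> 0" using c(1) c(2)[OF that] rat_pabs_0[OF p] by (cases "X i = 0") simp_all
    then show ?thesis by (simp add: rat_pabs_0[OF p])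
  qed
  then show ?thesis
    unfolding pnull_def by (intro tendsto_eventually) (auto simp: eventually_sequentially)
qed

lemma pnull_inverse_diff:
  assumes X: "pcauchy p X" "\<not> pnull p X" and Y: "pcauchy p Y" "\<not> pnull p Y"
    and XY: "pnull p (\<lambda>i. X i - Y i)"
  shows "pnull p (\<lambda>i. inverse (X i) - inverse (Y i))"
proof -
  obtain c K where c: "c > 0" "\<And>i. i \<ge> K \<Longrightarrow> rat_pabs p (X i) > c"
    using pcauchy_bounded_below[OF X] by blast
  obtain d L where d: "d > 0" "\<And>i. i \<ge> L \<Longrightarrow> rat_pabs p (Y i) > d"
    using pcauchy_bounded_below[OF Y] by blast
  have "pnull p (\<lambda>i. (inverse (X i) * inverse (Y i)) * (Y i - X i))"
    by (rule pnull_mult[OF pcauchy_mult[OF pcauchy_inverse[OF X] pcauchy_inverse[OF Y]]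
          pnull_diff_commute[OF XY]])
  moreover have "\<forall>\<^sub>F i in sequentially.
      rat_pabs p ((inverse (X i) * inverse (Y i)) * (Y i - X i)) = rat_pabs p (inverse (X i) - inverse (Y i))"
    unfolding eventually_sequentially
  proof (intro exI[of _ "max K L"] allI impI)
    fix i assume "i \<ge> max K L"
    then have gt: "rat_pabs p (X i) > c" "rat_pabs p (Y i) > d" using c(2) d(2) by simp_all
    have "X i \<noteq> 0" using gt(1) c(1) rat_pabs_0[OF p] by (cases "X i = 0") simp_all
    moreover have "Y i \<noteq> 0" using gt(2) d(1) rat_pabs_0[OF p] by (cases "Y i = 0") simp_all
    ultimately have "(inverse (X i) * inverse (Y i)) * (Y i - X i) = inverse (X i) - inverse (Y i)"
      by (simp add: field_simps)
    then show "rat_pabs p ((inverse (X i) * inverse (Y i)) * (Y i - X i))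
        = rat_pabs p (inverse (X i) - inverse (Y i))"
      by (rule arg_cong)
  qed
  ultimately show ?thesis
    unfolding pnull_def by (rule Lim_transform_eventually)
qed

end


section \<open>The field of \<open>p\<close>-adic numbers\<close>

text \<open>
  As with \<open>real ^ 'n\<close>, the parameter is carried by a type: \<open>p\<close> is \<open>CARD('p)\<close>, where \<open>'p\<close> is
  an arbitrary type of prime cardinality. Then \<open>'p padic\<close> is the completion of the rationals
  for the absolute value \<open>rat_pabs p\<close>: Cauchy sequences modulo null sequences.
\<close>

typedef ('p :: prime_card) cseq = "{X. pcauchy CARD('p) X}"
  using pcauchy_const[OF prime_card] by blast

setup_lifting type_definition_cseq

lift_definition cseq_rel :: "'p::prime_card cseq \<Rightarrow> 'p cseq \<Rightarrow> bool"
  is "\<lambda>X Y. pnull CARD('p) (\<lambda>i. X i - Y i)" .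

lemma equivp_cseq_rel: "equivp (cseq_rel :: 'p::prime_card cseq \<Rightarrow> _)"
proof (rule equivpI)
  show "reflp (cseq_rel :: 'p cseq \<Rightarrow> _)"
    by (rule reflpI, transfer) (simp add: pnull_0[OF prime_card])
  show "symp (cseq_rel :: 'p cseq \<Rightarrow> _)"
    by (rule sympI, transfer) (rule pnull_diff_commute[OF prime_card])
  show "transp (cseq_rel :: 'p cseq \<Rightarrow> _)"
  proof (rule transpI, transfer)
    fix X Y Z assume "pnull CARD('p) (\<lambda>i. X i - Y i)" "pnull CARD('p) (\<lambda>i. Y i - Z i)"
    then show "pnull CARD('p) (\<lambda>i. X i - Z i)"
      using pnull_add[OF prime_card, of "\<lambda>i. X i - Y i" "\<lambda>i. Y i - Z i"] by simp
  qed
qed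

lift_definition cseq_const :: "rat \<Rightarrow> 'p::prime_card cseq" is "\<lambda>q _. q"
  by (rule pcauchy_const[OF prime_card])

lift_definition cseq_add :: "'p::prime_card cseq \<Rightarrow> 'p cseq \<Rightarrow> 'p cseq"
  is "\<lambda>X Y i. X i + Y i" by (rule pcauchy_add[OF prime_card])

lift_definition cseq_minus :: "'p::prime_card cseq \<Rightarrow> 'p cseq"
  is "\<lambda>X i. - X i" by (rule pcauchy_minus[OF prime_card])

lift_definition cseq_mult :: "'p::prime_card cseq \<Rightarrow> 'p cseq \<Rightarrow> 'p cseq"
  is "\<lambda>X Y i. X i * Y i" by (rule pcauchy_mult[OF prime_card])

lift_definition cseq_inverse :: "'p::prime_card cseq \<Rightarrow> 'p cseq"
  is "\<lambda>X. if pnull CARD('p) X then (\<lambda>_. 0) else (\<lambda>i. inverse (X i))"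
  by (auto intro: pcauchy_inverse[OF prime_card] pcauchy_const[OF prime_card])

lift_definition cseq_abs :: "'p::prime_card cseq \<Rightarrow> real"
  is "\<lambda>X. lim (\<lambda>i. rat_pabs CARD('p) (X i))" .

quotient_type 'p padic = "'p::prime_card cseq" / cseq_rel
  by (rule equivp_cseq_rel)

instantiation padic :: (prime_card) field
begin

lift_definition zero_padic :: "'a padic" is "cseq_const 0" .

lift_definition one_padic :: "'a padic" is "cseq_const 1" .

lift_definition plus_padic :: "'a padic \<Rightarrow> 'a padic \<Rightarrow> 'a padic" is cseq_add
proof transfer
  fix X X' Y Y'
  assume "pnull CARD('a) (\<lambda>i. X i - X' i)" "pnull CARD('a) (\<lambda>i. Y i - Y' i)"
  then show "pnull CARD('a) (\<lambda>i. X i + Y i - (X' i + Y' i))"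
    using pnull_add[OF prime_card, of "\<lambda>i. X i - X' i" "\<lambda>i. Y i - Y' i"]
    by (simp add: algebra_simps)
qed

lift_definition uminus_padic :: "'a padic \<Rightarrow> 'a padic" is cseq_minus
  by transfer (drule pnull_minus[OF prime_card], simp)

definition minus_padic :: "'a padic \<Rightarrow> 'a padic \<Rightarrow> 'a padic" where
  "minus_padic x y = x + - y"

lift_definition times_padic :: "'a padic \<Rightarrow> 'a padic \<Rightarrow> 'a padic" is cseq_mult
proof transfer
  fix X X' Y Y'
  assume "pcauchy CARD('a) X" "pcauchy CARD('a) Y'"
    "pnull CARD('a) (\<lambda>i. X i - X' i)" "pnull CARD('a) (\<lambda>i. Y i - Y' i)"
  then have "pnull CARD('a) (\<lambda>i. X i * (Y i - Y' i) + Y' i * (X i - X' i))"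
    by (intro pnull_add[OF prime_card] pnull_mult[OF prime_card])
  then show "pnull CARD('a) (\<lambda>i. X i * Y i - X' i * Y' i)"
    by (simp add: algebra_simps)
qed

lift_definition inverse_padic :: "'a padic \<Rightarrow> 'a padic" is cseq_inverse
proof transfer
  fix X Y
  assume *: "pcauchy CARD('a) X" "pcauchy CARD('a) Y" "pnull CARD('a) (\<lambda>i. X i - Y i)"
  have "pnull CARD('a) X \<longleftrightarrow> pnull CARD('a) Y"
    using pnull_cong[OF prime_card *(3)] .
  then show "pnull CARD('a)
      (\<lambda>i. (if pnull CARD('a) X then \<lambda>_. 0 else (\<lambda>i. inverse (X i))) i -
           (if pnull CARD('a) Y then \<lambda>_. 0 else (\<lambda>i. inverse (Y i))) i)"
    using * pnull_inverse_diff[OF prime_card] pnull_0[OF prime_card] by auto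
qed

definition divide_padic :: "'a padic \<Rightarrow> 'a padic \<Rightarrow> 'a padic" where
  "divide_padic x y = x * inverse y"

instance
proof
  fix x y z :: "'a padic"
  note null = pnull_0[OF prime_card[where 'a = 'a]]
  show "x + y + z = x + (y + z)" by (transfer, transfer) (simp add: null algebra_simps)
  show "x + y = y + x" by (transfer, transfer) (simp add: null algebra_simps)
  show "0 + x = x" by (transfer, transfer) (simp add: null)
  show "- x + x = 0" by (transfer, transfer) (simp add: null)
  show "x - y = x + - y" by (simp add: minus_padic_def)
  show "x * y * z = x * (y * z)" by (transfer, transfer) (simp add: null algebra_simps)
  show "x * y = y * x" by (transfer, transfer) (simp add: null algebra_simps)
  show "1 * x = x" by (transfer, transfer) (simp add: null)
  show "(x + y) * z = x * z + y * z" by (transfer, transfer) (simp add: null algebra_simps)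
  show "(0 :: 'a padic) \<noteq> 1"
    by (transfer, transfer) (simp add: pnull_def rat_pabs_minus[OF prime_card] rat_pabs_1[OF prime_card] LIMSEQ_const_iff)
  show "x \<noteq> 0 \<Longrightarrow> inverse x * x = 1"
    by (transfer, transfer) (simp add: pnull_mult_inverse[OF prime_card])
  show "x div y = x * inverse y" by (simp add: divide_padic_def)
  show "inverse (0 :: 'a padic) = 0" by (transfer, transfer) (simp add: null)
qed

end

text \<open>
  The trivial Euclidean structure of a field; it is what the library needs in order to
  reduce fractions of polynomials to lowest terms.
\<close>

instantiation padic :: (prime_card)
  "{unique_euclidean_ring, normalization_euclidean_semiring, normalization_semidom_multiplicative}"
begin

definition [simp]: "normalize_padic = (normalize_field :: 'a padic \<Rightarrow> _)"
definition [simp]: "unit_factor_padic = (unit_factor_field :: 'a padic \<Rightarrow> _)"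
definition [simp]: "modulo_padic = (mod_field :: 'a padic \<Rightarrow> _)"
definition [simp]: "euclidean_size_padic = (euclidean_size_field :: 'a padic \<Rightarrow> _)"
definition [simp]: "division_segment_padic (x :: 'a padic) = (1 :: 'a padic)"

instance
  by standard
    (simp_all add: dvd_field_iff field_split_simps split: if_splits)

end

instantiation padic :: (prime_card) euclidean_ring_gcd
begin

definition gcd_padic :: "'a padic \<Rightarrow> 'a padic \<Rightarrow> 'a padic" where
  "gcd_padic = Euclidean_Algorithm.gcd"
definition lcm_padic :: "'a padic \<Rightarrow> 'a padic \<Rightarrow> 'a padic" where
  "lcm_padic = Euclidean_Algorithm.lcm"
definition Gcd_padic :: "'a padic set \<Rightarrow> 'a padic" where
  "Gcd_padic = Euclidean_Algorithm.Gcd"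
definition Lcm_padic :: "'a padic set \<Rightarrow> 'a padic" where
  "Lcm_padic = Euclidean_Algorithm.Lcm"

instance by standard (simp_all add: gcd_padic_def lcm_padic_def Gcd_padic_def Lcm_padic_def)

end

instance padic :: (prime_card) field_gcd ..


section \<open>Fields with a non-archimedean absolute value\<close>

class nonarch_field = field +
  fixes vabs :: "'a \<Rightarrow> real"
  assumes vabs_nonneg: "vabs x \<ge> 0"
    and vabs_eq_0_iff [simp]: "vabs x = 0 \<longleftrightarrow> x = 0"
    and vabs_mult: "vabs (x * y) = vabs x * vabs y"
    and vabs_add: "vabs (x + y) \<le> max (vabs x) (vabs y)"

instantiation padic :: (prime_card) nonarch_field
begin

lift_definition vabs_padic :: "'a padic \<Rightarrow> real" is cseq_abs
proof transfer
  fix X Y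
  assume *: "pcauchy CARD('a) X" "pcauchy CARD('a) Y" "pnull CARD('a) (\<lambda>i. X i - Y i)"
  obtain l where l: "(\<lambda>i. rat_pabs CARD('a) (Y i)) \<longlonglongrightarrow> l"
    using pcauchy_convergent[OF prime_card *(2)] by (auto simp: convergent_def)
  have "(\<lambda>i. rat_pabs CARD('a) (X i) - rat_pabs CARD('a) (Y i)) \<longlonglongrightarrow> 0"
    using *(3) unfolding pnull_def
    by (rule tendsto_0_le[where K = 1])
      (simp add: rat_pabs_abs_diff[OF prime_card] rat_pabs_nonneg[OF prime_card])
  from tendsto_add[OF this l] have "(\<lambda>i. rat_pabs CARD('a) (X i)) \<longlonglongrightarrow> l" by simp
  from limI[OF this] limI[OF l]
  show "lim (\<lambda>i. rat_pabs CARD('a) (X i)) = lim (\<lambda>i. rat_pabs CARD('a) (Y i))"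
    by (rule trans[OF _ sym])
qed

instance
proof
  fix x y :: "'a padic"
  have lim: "(\<lambda>i. rat_pabs CARD('a) (X i)) \<longlonglongrightarrow> lim (\<lambda>i. rat_pabs CARD('a) (X i))"
    if "pcauchy CARD('a) X" for X
    using pcauchy_convergent[OF prime_card that] by (simp add: convergent_LIMSEQ_iff)
  show "vabs x \<ge> 0"
  proof (transfer, transfer)
    fix X assume "pcauchy CARD('a) X"
    from LIMSEQ_le_const[OF lim[OF this], of 0]
    show "0 \<le> lim (\<lambda>i. rat_pabs CARD('a) (X i))"
      using rat_pabs_nonneg[OF prime_card] by blast
  qed
  show "vabs x = 0 \<longleftrightarrow> x = 0"
  proof (transfer, transfer)
    fix X assume "pcauchy CARD('a) X"
    note X = lim[OF this]
    have "lim (\<lambda>i. rat_pabs CARD('a) (X i)) = 0 \<longleftrightarrow> pnull CARD('a) X"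
      unfolding pnull_def using X limI by metis
    then show "lim (\<lambda>i. rat_pabs CARD('a) (X i)) = 0 \<longleftrightarrow> pnull CARD('a) (\<lambda>i. X i - 0)"
      by simp
  qed
  show "vabs (x * y) = vabs x * vabs y"
  proof (transfer, transfer)
    fix X Y assume XY: "pcauchy CARD('a) X" "pcauchy CARD('a) Y"
    show "lim (\<lambda>i. rat_pabs CARD('a) (X i * Y i))
        = lim (\<lambda>i. rat_pabs CARD('a) (X i)) * lim (\<lambda>i. rat_pabs CARD('a) (Y i))"
      unfolding rat_pabs_mult[OF prime_card]
      by (rule limI[OF tendsto_mult[OF lim[OF XY(1)] lim[OF XY(2)]]])
  qed
  show "vabs (x + y) \<le> max (vabs x) (vabs y)"
  proof (transfer, transfer)
    fix X Y assume XY: "pcauchy CARD('a) X" "pcauchy CARD('a) Y"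
    show "lim (\<lambda>i. rat_pabs CARD('a) (X i + Y i))
        \<le> max (lim (\<lambda>i. rat_pabs CARD('a) (X i))) (lim (\<lambda>i. rat_pabs CARD('a) (Y i)))"
      using rat_pabs_add[OF prime_card]
      by (intro LIMSEQ_le[OF lim[OF pcauchy_add[OF prime_card XY]]
            tendsto_max[OF lim[OF XY(1)] lim[OF XY(2)]]]) blast
  qed
qed

end


section \<open>The projective line and the spherical metric\<close>

definition proj_rel :: "'a::field \<times> 'a \<Rightarrow> 'a \<times> 'a \<Rightarrow> bool" where
  "proj_rel P Q \<longleftrightarrow> P \<noteq> (0, 0) \<and> Q \<noteq> (0, 0) \<and> (\<exists>c. c \<noteq> 0 \<and> fst Q = c * fst P \<and> snd Q = c * snd P)"

lemma part_equivp_proj_rel: "part_equivp (proj_rel :: 'a::field \<times> 'a \<Rightarrow> _)"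
proof (rule part_equivpI)
  show "\<exists>P :: 'a \<times> 'a. proj_rel P P" by (rule exI[of _ "(1, 0)"]) (auto simp: proj_rel_def)
  show "symp (proj_rel :: 'a \<times> 'a \<Rightarrow> _)"
  proof (rule sympI)
    fix P Q :: "'a \<times> 'a" assume PQ: "proj_rel P Q"
    then obtain c where c: "c \<noteq> 0" "fst Q = c * fst P" "snd Q = c * snd P"
      by (auto simp: proj_rel_def)
    then have "fst P = inverse c * fst Q" "snd P = inverse c * snd Q" "inverse c \<noteq> 0" by auto
    then show "proj_rel Q P" using PQ unfolding proj_rel_def by blast
  qed
  show "transp (proj_rel :: 'a \<times> 'a \<Rightarrow> _)"
  proof (rule transpI)
    fix P Q R :: "'a \<times> 'a" assume PQR: "proj_rel P Q" "proj_rel Q R"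
    then obtain c d where "c \<noteq> 0" "fst Q = c * fst P" "snd Q = c * snd P"
      "d \<noteq> 0" "fst R = d * fst Q" "snd R = d * snd Q"
      by (auto simp: proj_rel_def)
    then have "d * c \<noteq> 0" "fst R = d * c * fst P" "snd R = d * c * snd P" by auto
    then show "proj_rel P R" using PQR unfolding proj_rel_def by blast
  qed
qed

quotient_type (overloaded) 'a proj_line = "'a::field \<times> 'a" / partial: proj_rel
  by (rule part_equivp_proj_rel)

lemma proj_rel_refl: "proj_rel P P \<longleftrightarrow> P \<noteq> (0, 0)"
  unfolding proj_rel_def by (auto intro: exI[of _ 1])

lemma proj_rel_iff:
  fixes a b c d :: "'a::field"
  shows "proj_rel (a, b) (c, d) \<longleftrightarrow> (a, b) \<noteq> (0, 0) \<and> (c, d) \<noteq> (0, 0) \<and> a * d = c * b"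
proof
  assume "proj_rel (a, b) (c, d)"
  then show "(a, b) \<noteq> (0, 0) \<and> (c, d) \<noteq> (0, 0) \<and> a * d = c * b"
    by (auto simp: proj_rel_def)
next
  assume *: "(a, b) \<noteq> (0, 0) \<and> (c, d) \<noteq> (0, 0) \<and> a * d = c * b"
  have "\<exists>e. e \<noteq> 0 \<and> c = e * a \<and> d = e * b"
  proof (cases "a = 0")
    case True
    then have "b \<noteq> 0" "c = 0" "d \<noteq> 0" using * by auto
    then show ?thesis using True by (intro exI[of _ "d / b"]) simp
  next
    case False
    then have "c \<noteq> 0" using * by auto
    moreover have "d = c / a * b" using * False by (simp add: field_simps)
    ultimately show ?thesis using False by (intro exI[of _ "c / a"]) simp
  qed
  then show "proj_rel (a, b) (c, d)" using * by (simp add: proj_rel_def)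
qed

lemma vabs_pos_iff: "vabs x > 0 \<longleftrightarrow> x \<noteq> (0 :: 'a::nonarch_field)"
  using vabs_nonneg[of x] vabs_eq_0_iff[of x] by linarith

definition hmax :: "'a::nonarch_field \<times> 'a \<Rightarrow> real" where
  "hmax P = max (vabs (fst P)) (vabs (snd P))"

lemma hmax_pos: "P \<noteq> (0, 0) \<Longrightarrow> hmax P > 0"
  by (cases P) (auto simp: hmax_def less_max_iff_disj vabs_pos_iff)

lemma hmax_scale: "hmax (c * x, c * y) = vabs c * hmax (x, y)"
  using vabs_nonneg[of c] by (simp add: hmax_def vabs_mult max_mult_distrib_left)

lemma vabs_1 [simp]: "vabs (1 :: 'a::nonarch_field) = 1"
  using vabs_mult[of "1::'a" 1] vabs_eq_0_iff[of "1::'a"] by simp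

lemma vabs_minus [simp]: "vabs (- x) = vabs (x :: 'a::nonarch_field)"
proof -
  have "vabs (- 1 :: 'a) * vabs (- 1 :: 'a) = 1"
    using vabs_mult[of "- 1 :: 'a" "- 1"] by simp
  then have "vabs (- 1 :: 'a) = 1"
    using vabs_nonneg[of "- 1 :: 'a"] by (metis abs_of_nonneg abs_1 abs_square_eq_1 power2_eq_square)
  then show ?thesis using vabs_mult[of "- 1" x] by simp
qed

definition cross :: "'a::field \<times> 'a \<Rightarrow> 'a \<times> 'a \<Rightarrow> 'a" where
  "cross P Q = fst P * snd Q - fst Q * snd P"

lemma cross_triangle:
  "hmax R * vabs (cross P Q) \<le> max (hmax Q * vabs (cross P R)) (hmax P * vabs (cross Q R))"
proof -
  have *: "vabs t * vabs (cross P Q) \<le> max (hmax Q * vabs (cross P R)) (hmax P * vabs (cross Q R))"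
    if "t * cross P Q = q * cross P R - r * cross Q R" "vabs q \<le> hmax Q" "vabs r \<le> hmax P" for t q r
  proof -
    have "vabs t * vabs (cross P Q) = vabs (q * cross P R + - (r * cross Q R))"
      using that(1) by (simp flip: vabs_mult)
    also have "\<dots> \<le> max (vabs (q * cross P R)) (vabs (r * cross Q R))"
      using vabs_add[of "q * cross P R" "- (r * cross Q R)"] by simp
    also have "\<dots> \<le> max (hmax Q * vabs (cross P R)) (hmax P * vabs (cross Q R))"
      unfolding vabs_mult using that(2,3) by (intro max.mono mult_right_mono vabs_nonneg)
    finally show ?thesis .
  qed
  have "vabs (fst R) * vabs (cross P Q) \<le> max (hmax Q * vabs (cross P R)) (hmax P * vabs (cross Q R))"
    by (rule *[where q = "fst Q" and r = "fst P"]) (auto simp: cross_def hmax_def algebra_simps)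
  moreover have "vabs (snd R) * vabs (cross P Q) \<le> max (hmax Q * vabs (cross P R)) (hmax P * vabs (cross Q R))"
    by (rule *[where q = "snd Q" and r = "snd P"]) (auto simp: cross_def hmax_def algebra_simps)
  ultimately show ?thesis by (simp add: hmax_def max_def split: if_splits)
qed

definition spherical :: "'a::nonarch_field \<times> 'a \<Rightarrow> 'a \<times> 'a \<Rightarrow> real" where
  "spherical = (\<lambda>(x1, y1) (x2, y2).
     vabs (x1 * y2 - x2 * y1) / (max (vabs x1) (vabs y1) * max (vabs x2) (vabs y2)))"

lemma spherical_eq: "spherical P Q = vabs (cross P Q) / (hmax P * hmax Q)"
  by (simp add: spherical_def case_prod_unfold cross_def hmax_def)

lemma spherical_cong:
  assumes P: "proj_rel P P'" and Q: "proj_rel Q Q'"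
  shows "spherical P Q = spherical P' Q'"
proof -
  obtain c where c: "c \<noteq> 0" "P' = (c * fst P, c * snd P)"
    using P by (auto simp: proj_rel_def prod_eq_iff)
  obtain d where d: "d \<noteq> 0" "Q' = (d * fst Q, d * snd Q)"
    using Q by (auto simp: proj_rel_def prod_eq_iff)
  have 1: "cross P' Q' = c * d * cross P Q" by (simp add: c d cross_def algebra_simps)
  have 2: "hmax P' = vabs c * hmax P" "hmax Q' = vabs d * hmax Q"
    by (simp_all add: c d hmax_scale)
  show ?thesis using c(1) d(1) unfolding spherical_eq 1 2 vabs_mult by simp
qed

lemma spherical_eq_0_iff:
  assumes "P \<noteq> (0, 0)" "Q \<noteq> (0, 0)"
  shows "spherical P Q = 0 \<longleftrightarrow> proj_rel P Q"
proof -
  have "spherical P Q = 0 \<longleftrightarrow> cross P Q = 0"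
    using hmax_pos[OF assms(1)] hmax_pos[OF assms(2)] by (simp add: spherical_eq)
  then show ?thesis
    using assms proj_rel_iff[of "fst P" "snd P" "fst Q" "snd Q"] by (simp add: cross_def)
qed

lemma spherical_triangle:
  assumes "P \<noteq> (0, 0)" "Q \<noteq> (0, 0)" "R \<noteq> (0, 0)"
  shows "spherical P Q \<le> spherical P R + spherical Q R"
proof -
  note pos = hmax_pos[OF assms(1)] hmax_pos[OF assms(2)] hmax_pos[OF assms(3)]
  have "0 \<le> hmax Q * vabs (cross P R)" "0 \<le> hmax P * vabs (cross Q R)"
    using pos by (simp_all add: vabs_nonneg)
  then have "hmax R * vabs (cross P Q) \<le> hmax Q * vabs (cross P R) + hmax P * vabs (cross Q R)"
    using cross_triangle[of R P Q] by linarith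
  then have "hmax R * vabs (cross P Q) / (hmax P * hmax Q * hmax R)
      \<le> (hmax Q * vabs (cross P R) + hmax P * vabs (cross Q R)) / (hmax P * hmax Q * hmax R)"
    using pos by (intro divide_right_mono) simp_all
  then show ?thesis using pos by (simp add: spherical_eq add_divide_distrib mult_ac)
qed

instantiation proj_line :: (nonarch_field) metric_space
begin

lift_definition dist_proj_line :: "'a proj_line \<Rightarrow> 'a proj_line \<Rightarrow> real" is spherical
  by (rule spherical_cong)

definition uniformity_proj_line :: "('a proj_line \<times> 'a proj_line) filter" where
  "uniformity_proj_line = (INF e\<in>{0<..}. principal {(x, y). dist x y < e})"

definition open_proj_line :: "'a proj_line set \<Rightarrow> bool" where
  "open_proj_line U \<longleftrightarrow> (\<forall>x\<in>U. eventually (\<lambda>(x', y). x' = x \<longrightarrow> y \<in> U) uniformity)"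

instance
proof
  show "(uniformity :: ('a proj_line \<times> 'a proj_line) filter) =
      (INF e\<in>{0<..}. principal {(x, y). dist x y < e})"
    by (rule uniformity_proj_line_def)
  show "open U \<longleftrightarrow> (\<forall>x\<in>U. eventually (\<lambda>(x', y). x' = x \<longrightarrow> y \<in> U) uniformity)"
    for U :: "'a proj_line set"
    by (rule open_proj_line_def)
  show "dist P Q = 0 \<longleftrightarrow> P = Q" for P Q :: "'a proj_line"
    by transfer (simp add: proj_rel_refl spherical_eq_0_iff)
  show "dist P Q \<le> dist P R + dist Q R" for P Q R :: "'a proj_line"
    by transfer (simp add: proj_rel_refl spherical_triangle)
qed

end


section \<open>Rational maps\<close>

text \<open>The homogenisation \<open>y ^ d * f (x / y)\<close> of a polynomial \<open>f\<close> of degree at most \<open>d\<close>.\<close>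

definition hom_eval :: "nat \<Rightarrow> 'a::comm_semiring_1 poly \<Rightarrow> 'a \<Rightarrow> 'a \<Rightarrow> 'a" where
  "hom_eval d f x y = (\<Sum>i\<le>d. coeff f i * x ^ i * y ^ (d - i))"

lemma hom_eval_scale: "hom_eval d f (c * x) (c * y) = c ^ d * hom_eval d f x y"
proof -
  have "coeff f i * (c * x) ^ i * (c * y) ^ (d - i) = c ^ d * (coeff f i * x ^ i * y ^ (d - i))"
    if "i \<le> d" for i
  proof -
    have "c ^ d = c ^ i * c ^ (d - i)" using that by (simp flip: power_add)
    then show ?thesis by (simp add: power_mult_distrib mult_ac)
  qed
  then show ?thesis by (simp add: hom_eval_def sum_distrib_left)
qed

lemma hom_eval_nonzero:
  fixes x y :: "'a::field"
  assumes y: "y \<noteq> 0" and d: "degree f \<le> d"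
  shows "hom_eval d f x y = y ^ d * poly f (x / y)"
proof -
  have "poly f (x / y) = (\<Sum>i\<le>d. coeff f i * (x / y) ^ i)"
    unfolding poly_altdef using d by (intro sum.mono_neutral_left) (auto simp: coeff_eq_0)
  moreover have "y ^ d * (coeff f i * (x / y) ^ i) = coeff f i * x ^ i * y ^ (d - i)" if "i \<le> d" for i
    using y that by (simp add: power_divide power_diff)
  then have "(\<Sum>i\<le>d. y ^ d * (coeff f i * (x / y) ^ i)) = hom_eval d f x y"
    unfolding hom_eval_def by (intro sum.cong) auto
  ultimately show ?thesis by (simp add: sum_distrib_left)
qed

lemma hom_eval_infinity: "hom_eval d f x 0 = coeff f d * x ^ d"
proof -
  have "hom_eval d f x 0 = (\<Sum>i\<in>{d}. coeff f i * x ^ i * 0 ^ (d - i))"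
    unfolding hom_eval_def by (rule sum.mono_neutral_right) (auto simp: power_0_left)
  then show ?thesis by simp
qed

lemma hom_eval_coprime:
  fixes f g :: "'a::field poly"
  assumes "coprime f g" and d: "d = max (degree f) (degree g)" and xy: "(x, y) \<noteq> (0, 0)"
  shows "(hom_eval d f x y, hom_eval d g x y) \<noteq> (0, 0)"
proof
  assume 0: "(hom_eval d f x y, hom_eval d g x y) = (0, 0)"
  show False
  proof (cases "y = 0")
    case True
    then have "coeff f d = 0" "coeff g d = 0"
      using 0 xy by (auto simp: hom_eval_infinity)
    moreover have "d = degree f \<or> d = degree g" using d by (simp add: max_def)
    ultimately have "f = 0 \<and> degree g \<le> degree f \<or> g = 0 \<and> degree f \<le> degree g"
      using d leading_coeff_0_iff[of f] leading_coeff_0_iff[of g] by auto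
    then have "f = 0 \<and> degree g = 0 \<or> g = 0 \<and> degree f = 0" by auto
    then have "f = 0 \<and> g = 0"
      using d \<open>coeff f d = 0\<close> \<open>coeff g d = 0\<close> leading_coeff_0_iff[of f] leading_coeff_0_iff[of g]
      by (metis degree_0 max.idem)
    then show False using assms(1) by simp
  next
    case False
    then have "poly f (x / y) = 0" "poly g (x / y) = 0"
      using 0 d by (auto simp: hom_eval_nonzero)
    then have "[:- (x / y), 1:] dvd f" "[:- (x / y), 1:] dvd g"
      by (simp_all add: poly_eq_0_iff_dvd)
    then have "is_unit [:- (x / y), 1:]"
      using assms(1) by (meson coprime_common_divisor)
    then show False by (simp add: is_unit_pCons_iff)
  qed
qed

text \<open>
  The map induced by a rational function \<open>r = f / g\<close> in lowest terms is
  \<open>[x, y] \<mapsto> [F(x, y), G(x, y)]\<close> with \<open>F, G\<close> the homogenisations of \<open>f, g\<close> in degree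
  \<open>max (degree f) (degree g)\<close>.
\<close>

lift_definition ratmap :: "'a::field_gcd poly fract \<Rightarrow> 'a proj_line \<Rightarrow> 'a proj_line" is
  "\<lambda>r (x, y). let (f, g) = quot_of_fract r; d = max (degree f) (degree g)
     in (hom_eval d f x y, hom_eval d g x y)"
proof -
  fix r :: "'a poly fract" and P P' :: "'a \<times> 'a"
  assume P: "proj_rel P P'"
  obtain f g where fg: "quot_of_fract r = (f, g)" by force
  then have cop: "coprime f g" using coprime_quot_of_fract[of r] by simp
  define d where "d = max (degree f) (degree g)"
  obtain x y where xy: "P = (x, y)" by force
  obtain c where c: "c \<noteq> 0" "P' = (c * x, c * y)"
    using P by (auto simp: proj_rel_def prod_eq_iff xy)
  have "(x, y) \<noteq> (0, 0)" "(c * x, c * y) \<noteq> (0, 0)" using P c xy by (auto simp: proj_rel_def)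
  then have "proj_rel (hom_eval d f x y, hom_eval d g x y)
      (hom_eval d f (c * x) (c * y), hom_eval d g (c * x) (c * y))"
    using hom_eval_coprime[OF cop d_def] c
    by (auto simp: proj_rel_def hom_eval_scale intro!: exI[of _ "c ^ d"])
  then show "proj_rel
      ((case P of (x, y) \<Rightarrow> let (f, g) = quot_of_fract r; d = max (degree f) (degree g)
         in (hom_eval d f x y, hom_eval d g x y)))
      ((case P' of (x, y) \<Rightarrow> let (f, g) = quot_of_fract r; d = max (degree f) (degree g)
         in (hom_eval d f x y, hom_eval d g x y)))"
    by (simp add: xy c fg d_def Let_def)
qed

text \<open>The variable \<open>z\<close> of the field of rational functions.\<close>

definition indet :: "'a::idom poly fract" where
  "indet = Fraction_Field.Fract [:0, 1:] 1"


section \<open>The Fatou set\<close>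

text \<open>
  Equicontinuity at every point of \<open>U\<close>; \<open>\<delta>\<close> may depend on the point. Requiring a \<open>\<delta>\<close> uniform
  on \<open>U\<close> instead could only make the Fatou set smaller.
\<close>

definition equicontinuous_on :: "'a::metric_space set \<Rightarrow> ('a \<Rightarrow> 'b::metric_space) set \<Rightarrow> bool" where
  "equicontinuous_on U F \<longleftrightarrow>
     (\<forall>x\<in>U. \<forall>e>0. \<exists>d>0. \<forall>y\<in>U. dist x y < d \<longrightarrow> (\<forall>f\<in>F. dist (f x) (f y) < e))"

definition fatou_set :: "('a::metric_space \<Rightarrow> 'a) \<Rightarrow> 'a set" where
  "fatou_set f = {x. \<exists>U. open U \<and> x \<in> U \<and> equicontinuous_on U (range (\<lambda>k. f ^^ k))}"

end

theory Submission
  imports Defs "HOL-Number_Theory.Residues"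
begin

text \<open>
  On the unit ball the numerator and the denominator of \<open>\<phi>\<close> are divisible by \<open>p\<close>, by Fermat's
  little theorem, and the denominator has absolute value exactly \<open>1 / p\<close>. Since \<open>x \<mapsto> x ^ p\<close>
  contracts each residue class by a factor of at least \<open>p\<close>, the term \<open>- z / p\<close> dominates and \<open>\<phi>\<close>
  multiplies distances within a residue class by exactly \<open>p\<close>. Hence any two distinct points of
  the unit ball are eventually moved to distance \<open>1\<close>. The whole projective line is mapped into
  the unit ball in one step, and \<open>\<phi>\<close> is not constant near any point, so that every neighbourhood
  of any point \<open>P\<close> contains a point which is eventually at distance \<open>1\<close> from the orbit of \<open>P\<close>.
\<close>

section \<open>Integers in the \<open>p\<close>-adic numbers\<close>

lemma int_pabs_not_dvd:
  assumes "prime p" "\<not> int p dvd a"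
  shows "int_pabs p a = 1"
  using assms by (auto simp: int_pabs_def not_dvd_imp_multiplicity_0)

lemma int_pabs_dvd_le:
  assumes "prime p" "int p dvd a"
  shows "int_pabs p a \<le> 1 / real p"
proof (cases "a = 0")
  case False
  then have "multiplicity (int p) a \<ge> 1"
    using assms by (intro multiplicity_geI) (auto simp: prime_gt_0_nat)
  then have "real p ^ 1 \<le> real p ^ multiplicity (int p) a"
    using prime_ge_1_nat[OF assms(1)] by (intro power_increasing) auto
  then show ?thesis
    using False prime_gt_0_nat[OF assms(1)]
    by (auto simp: int_pabs_def inverse_eq_divide intro!: divide_left_mono)
qed (simp add: int_pabs_def)

lemma int_pabs_le_1:
  assumes "prime p"
  shows "int_pabs p a \<le> 1"
proof (cases "int p dvd a")
  case True
  have "1 / real p \<le> 1" using prime_ge_1_nat[OF assms] by simp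
  then show ?thesis using int_pabs_dvd_le[OF assms True] by linarith
qed (simp add: int_pabs_not_dvd assms)

lemma rat_pabs_of_int: "prime p \<Longrightarrow> rat_pabs p (of_int a) = int_pabs p a"
  using rat_pabs_Fract[of p 1 a] by (simp add: int_pabs_def)

text \<open>Reduction of the \<open>p\<close>-integral rationals onto the integers modulo
  \<open>p\<close>: in lowest terms \<open>a / b\<close> the denominator is prime to
  \<open>p\<close>, so \<open>k\<close> can be the residue of \<open>a\<close> times an inverse of
  \<open>b\<close>.\<close>

lemma rat_pabs_approx_nat:
  assumes p: "prime p" and q: "rat_pabs p q \<le> 1"
  shows "\<exists>k::nat. rat_pabs p (q - of_nat k) \<le> 1 / real p"
proof -
  obtain a b where ab: "quotient_of q = (a, b)" by force
  have b: "b > 0" using quotient_of_denom_pos[OF ab] .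
  have cop: "coprime a b" using quotient_of_coprime[OF ab] .
  have q_eq: "q = of_int a / of_int b" using quotient_of_div[OF ab] .
  have p1: "real p > 1" using prime_gt_1_nat[OF p] by simp
  have ndvd: "\<not> int p dvd b"
  proof
    assume dvd: "int p dvd b"
    then have "\<not> int p dvd a"
      using cop p by (meson coprime_common_divisor not_prime_unit prime_nat_int_transfer)
    then have "rat_pabs p q = 1 / int_pabs p b"
      using int_pabs_not_dvd[OF p] ab by (simp add: rat_pabs_def)
    moreover have "int_pabs p b > 0"
      using int_pabs_nonneg[OF p, of b] int_pabs_eq_0_iff[OF p, of b] b by linarith
    ultimately have "1 \<le> int_pabs p b" using q by (simp add: divide_le_eq)
    then have "1 \<le> 1 / real p" using int_pabs_dvd_le[OF p dvd] by linarith
    then show False using p1 by (simp add: field_simps)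
  qed
  then have "coprime b (int p)"
    using p by (metis coprime_commute prime_imp_coprime prime_nat_int_transfer)
  then obtain x where x: "[b * x = 1] (mod int p)" using cong_solve_coprime_int by blast
  define k where "k = nat ((a * x) mod int p)"
  have k: "int k = (a * x) mod int p" using p1 by (simp add: k_def)
  have "[int k * b = a * x * b] (mod int p)" unfolding k by (simp add: cong_def mod_mult_left_eq)
  moreover have "[a * (b * x) = a * 1] (mod int p)" using x by (rule cong_scalar_left)
  ultimately have "[a = int k * b] (mod int p)" by (simp add: cong_def mult_ac)
  then have dvd: "int p dvd a - int k * b" by (simp add: cong_iff_dvd_diff)
  have "q - of_nat k = of_int (a - int k * b) / of_int b" using b by (simp add: q_eq field_simps)
  then have "rat_pabs p (q - of_nat k) = int_pabs p (a - int k * b) / int_pabs p b"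
    using rat_pabs_Fract[OF p, of b "a - int k * b"] b by (metis less_irrefl)
  also have "\<dots> \<le> 1 / real p" using int_pabs_dvd_le[OF p dvd] int_pabs_not_dvd[OF p ndvd] by simp
  finally show ?thesis by blast
qed

section \<open>Natural numbers in the \<open>p\<close>-adic field and approximation by them\<close>

lemma one_less_CARD: "1 < CARD('a::prime_card)"
  by (rule prime_gt_1_nat[OF prime_card])

lemma of_nat_padic: "(of_nat k :: 'p::prime_card padic) = abs_padic (cseq_const (of_nat k))"
proof (induction k)
  case (Suc k)
  have "cseq_add (cseq_const 1) (cseq_const (of_nat k)) = (cseq_const (of_nat (Suc k)) :: 'p cseq)"
    by transfer simp
  then show ?case by (simp add: Suc.IH one_padic_def plus_padic.abs_eq)
qed (simp add: zero_padic_def)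

lemma vabs_of_nat: "vabs (of_nat k :: 'p::prime_card padic) = int_pabs CARD('p) (int k)"
proof -
  have "cseq_abs (cseq_const (of_nat k) :: 'p cseq) = int_pabs CARD('p) (int k)"
    using rat_pabs_of_int[OF prime_card[where 'a = 'p], of "int k"] by transfer simp
  then show ?thesis by (simp add: of_nat_padic vabs_padic.abs_eq)
qed

lemma vabs_of_nat_le_1: "vabs (of_nat k :: 'p::prime_card padic) \<le> 1"
  by (simp add: vabs_of_nat int_pabs_le_1 prime_card)

lemma vabs_of_nat_CARD: "vabs (of_nat CARD('p) :: 'p::prime_card padic) = 1 / CARD('p)"
  using one_less_CARD[where 'a = 'p]
  by (simp add: vabs_of_nat int_pabs_def inverse_eq_divide multiplicity_self)

text \<open>Opens both layers of the construction, quotient and subtype, once and for all. A single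
  sequence serves every \<open>k\<close>; taking \<open>k = 0\<close> recovers \<open>vabs z\<close>
  itself.\<close>

lemma padic_cauchy_repr:
  obtains X where "pcauchy CARD('p) X"
    "\<And>k. (\<lambda>i. rat_pabs CARD('p) (X i - of_nat k)) \<longlonglongrightarrow> vabs (z - of_nat k :: 'p::prime_card padic)"
proof -
  obtain Z where z: "z = abs_padic Z" by (metis Quotient_abs_rep[OF Quotient_padic])
  define X where "X = Rep_cseq Z"
  have X: "pcauchy CARD('p) X" using Rep_cseq[of Z] by (simp add: X_def)
  show ?thesis
  proof (rule that[OF X])
    fix k
    let ?Y = "\<lambda>i. X i - of_nat k"
    have "z - of_nat k = abs_padic (cseq_add Z (cseq_minus (cseq_const (of_nat k))))"
      by (simp add: z of_nat_padic minus_padic_def uminus_padic.abs_eq plus_padic.abs_eq)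
    then have "vabs (z - of_nat k) = lim (\<lambda>i. rat_pabs CARD('p) (?Y i))"
      by (simp add: vabs_padic.abs_eq cseq_abs.rep_eq cseq_add.rep_eq cseq_minus.rep_eq
          cseq_const.rep_eq X_def)
    moreover have "pcauchy CARD('p) ?Y"
      using pcauchy_add[OF prime_card X pcauchy_const[OF prime_card, of "- of_nat k"]] by simp
    ultimately show "(\<lambda>i. rat_pabs CARD('p) (?Y i)) \<longlonglongrightarrow> vabs (z - of_nat k)"
      using pcauchy_convergent[OF prime_card] by (simp add: convergent_LIMSEQ_iff)
  qed
qed

text \<open>A late term of a representing sequence is a \<open>p\<close>-integral rational, hence
  close to some natural number, and the non-strict bound survives the limit. So every residue class
  of the unit ball contains a natural number.\<close>

lemma padic_approx_nat:
  assumes z: "vabs (z :: 'p::prime_card padic) \<le> 1"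
  shows "\<exists>k::nat. vabs (z - of_nat k) \<le> 1 / CARD('p)"
proof -
  let ?p = "CARD('p)"
  note p = prime_card[where 'a = 'p]
  have p1: "real ?p > 1" using prime_gt_1_nat[OF p] by simp
  obtain X where X: "pcauchy ?p X"
    and lim: "\<And>k. (\<lambda>i. rat_pabs ?p (X i - of_nat k)) \<longlonglongrightarrow> vabs (z - of_nat k)"
    using padic_cauchy_repr by blast
  \<comment> \<open>The tolerance \<open>1 / p\<close> lets an approximation of \<open>X K\<close>
    serve all later terms by the ultrametric inequality; being below 1, it also keeps
    \<open>X K\<close> integral.\<close>
  obtain K where K: "\<And>i. i \<ge> K \<Longrightarrow> rat_pabs ?p (X i - X K) < 1 / ?p"
    using X p1 unfolding pcauchy_def by (meson le_refl zero_less_divide_1_iff less_trans zero_less_one)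
  have "rat_pabs ?p (X K) \<le> 1"
  proof (rule ccontr)
    assume gt: "\<not> rat_pabs ?p (X K) \<le> 1"
    have "rat_pabs ?p (X K) \<le> rat_pabs ?p (X i)" if "i \<ge> K" for i
    proof -
      have "rat_pabs ?p (X K) \<le> max (rat_pabs ?p (X i)) (rat_pabs ?p (X K - X i))"
        using rat_pabs_add[OF p, of "X i" "X K - X i"] by simp
      moreover have "1 / real ?p < 1" using p1 by simp
      then have "rat_pabs ?p (X K - X i) < 1"
        using K[OF that] rat_pabs_diff_commute[OF p, of "X i" "X K"] by linarith
      ultimately show ?thesis using gt by linarith
    qed
    then have "rat_pabs ?p (X K) \<le> vabs z"
      using LIMSEQ_le_const[OF lim[of 0]] by auto
    then show False using z gt by simp
  qed
  then obtain k where k: "rat_pabs ?p (X K - of_nat k) \<le> 1 / ?p"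
    using rat_pabs_approx_nat[OF p] by blast
  have "rat_pabs ?p (X i - of_nat k) \<le> 1 / ?p" if "i \<ge> K" for i
    using K[OF that] k rat_pabs_add[OF p, of "X i - X K" "X K - of_nat k"] by simp
  then have "vabs (z - of_nat k) \<le> 1 / ?p"
    using LIMSEQ_le_const2[OF lim] by blast
  then show ?thesis by blast
qed

section \<open>Non-archimedean estimates\<close>

lemma vabs_0 [simp]: "vabs (0 :: 'a::nonarch_field) = 0"
  by simp

lemma vabs_power: "vabs (x ^ k) = vabs (x :: 'a::nonarch_field) ^ k"
  by (induction k) (simp_all add: vabs_mult)

lemma vabs_power_le_1: "vabs (z :: 'a::nonarch_field) \<le> 1 \<Longrightarrow> vabs (z ^ k) \<le> 1"
  by (simp add: vabs_power power_le_one vabs_nonneg)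

lemma vabs_divide: "vabs (x / y) = vabs x / vabs (y :: 'a::nonarch_field)"
proof (cases "y = 0")
  case False
  then have "vabs (x / y) * vabs y = vabs x" by (simp flip: vabs_mult)
  then show ?thesis using False by (simp add: field_simps)
qed simp

lemma vabs_diff_commute: "vabs (x - y) = vabs (y - x :: 'a::nonarch_field)"
  using vabs_minus[of "x - y"] by simp

lemma vabs_diff_le: "vabs (x - y :: 'a::nonarch_field) \<le> max (vabs x) (vabs y)"
  using vabs_add[of x "- y"] by simp

text \<open>Ultrametric triangles are isosceles: writing \<open>x\<close> as
  \<open>(x + y) - y\<close> gives the reverse inequality.\<close>

lemma vabs_add_dominant:
  assumes "vabs y < vabs x"
  shows "vabs (x + y :: 'a::nonarch_field) = vabs x"
  using assms vabs_add[of x y] vabs_diff_le[of "x + y" y] by auto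

lemma vabs_diff_dominant:
  assumes "vabs y < vabs x"
  shows "vabs (x - y :: 'a::nonarch_field) = vabs x"
  using vabs_add_dominant[of "- y" x] assms by simp

lemma vabs_sum_le:
  assumes "\<And>i. i \<in> A \<Longrightarrow> vabs (f i :: 'a::nonarch_field) \<le> B" "0 \<le> B"
  shows "vabs (\<Sum>i\<in>A. f i) \<le> B"
  using assms
proof (induction A rule: infinite_finite_induct)
  case (insert x A)
  then show ?case using vabs_add[of "f x" "sum f A"] by fastforce
qed simp_all

text \<open>The cofactor of \<open>z - w\<close> in \<open>z ^ k - w ^ k\<close> is a sum of
  products of integral elements, hence integral.\<close>

lemma vabs_power_diff_le:
  fixes z w :: "'a::nonarch_field"
  assumes "vabs z \<le> 1" "vabs w \<le> 1"
  shows "vabs (z ^ k - w ^ k) \<le> vabs (z - w)"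
proof -
  have "vabs (\<Sum>i<k. w ^ (k - Suc i) * z ^ i) \<le> 1"
    using assms by (intro vabs_sum_le) (auto simp: vabs_mult vabs_power vabs_nonneg power_le_one mult_le_one)
  then show ?thesis
    using vabs_nonneg[of "z - w"]
    by (simp add: power_diff_sumr2 vabs_mult mult_left_le)
qed

text \<open>Discreteness of the absolute value: a natural number within \<open>1 / p\<close> of
  \<open>z\<close> has absolute value below 1, so it is divisible by \<open>p\<close>.\<close>

lemma padic_vabs_lt_1:
  assumes "vabs (z :: 'p::prime_card padic) < 1"
  shows "vabs z \<le> 1 / CARD('p)"
proof -
  note p = prime_card[where 'a = 'p]
  have p1: "real CARD('p) > 1" using prime_gt_1_nat[OF p] by simp
  obtain k where k: "vabs (z - of_nat k) \<le> 1 / CARD('p)"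
    using padic_approx_nat[of z] assms by auto
  have "vabs (of_nat k :: 'p padic) < 1"
  proof -
    have "1 / real CARD('p) < 1" using p1 by simp
    moreover have "vabs (of_nat k :: 'p padic) \<le> max (vabs z) (vabs (z - of_nat k))"
      using vabs_diff_le[of z "z - of_nat k"] by simp
    ultimately show ?thesis using k assms by linarith
  qed
  then have "int CARD('p) dvd int k"
    using int_pabs_not_dvd[OF p, of "int k"] unfolding vabs_of_nat by linarith
  then have "vabs (of_nat k :: 'p padic) \<le> 1 / CARD('p)"
    using int_pabs_dvd_le[OF p] by (simp add: vabs_of_nat)
  then show ?thesis using k vabs_add[of "z - of_nat k" "of_nat k"] by simp
qed

text \<open>Fermat's little theorem holds for a natural number \<open>k\<close> in the residue class
  of \<open>z\<close>, and replacing \<open>z\<close> by \<open>k\<close> changes neither term by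
  more than \<open>1 / p\<close>.\<close>

lemma padic_fermat:
  assumes z: "vabs (z :: 'p::prime_card padic) \<le> 1"
  shows "vabs (z ^ CARD('p) - z) \<le> 1 / CARD('p)"
proof -
  let ?p = "CARD('p)"
  note p = prime_card[where 'a = 'p]
  obtain k where k: "vabs (z - of_nat k) \<le> 1 / ?p" using padic_approx_nat[OF z] by blast
  have "[k ^ ?p = k] (mod ?p)"
  proof (cases "?p dvd k")
    case False
    have "[k * k ^ (?p - 1) = k * 1] (mod ?p)"
      using fermat_theorem[OF p False] by (rule cong_scalar_left)
    then show ?thesis using p by (simp add: power_eq_if)
  next
    case True
    then have "?p dvd k ^ ?p" using p by (intro dvd_trans[OF _ dvd_power]) (auto simp: prime_gt_0_nat)
    then show ?thesis using True by (simp add: cong_def)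
  qed
  \<comment> \<open>Subtraction of natural numbers truncates, so this inequality is what makes
    \<open>k ^ p - k\<close> the true difference.\<close>
  moreover have le: "k \<le> k ^ ?p" using self_le_power[of k ?p] p by (cases "k = 0") (auto simp: prime_gt_0_nat)
  ultimately have dvd: "?p dvd k ^ ?p - k" by (simp add: cong_altdef_nat)
  have "vabs (of_nat k ^ ?p - of_nat k :: 'p padic) = vabs (of_nat (k ^ ?p - k) :: 'p padic)"
    using le by (simp add: of_nat_diff)
  then have *: "vabs (of_nat k ^ ?p - of_nat k :: 'p padic) \<le> 1 / ?p"
    unfolding vabs_of_nat using int_pabs_dvd_le[OF p] dvd by (simp only: int_dvd_int_iff)
  have "vabs (z ^ ?p - of_nat k ^ ?p) \<le> 1 / ?p"
    using vabs_power_diff_le[OF z vabs_of_nat_le_1, of ?p k] k by linarith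
  then have "vabs (z ^ ?p - of_nat k ^ ?p + (of_nat k ^ ?p - of_nat k)) \<le> 1 / ?p"
    using * vabs_add[of "z ^ ?p - of_nat k ^ ?p" "of_nat k ^ ?p - of_nat k"] by linarith
  then have "vabs ((z ^ ?p - of_nat k) - (z - of_nat k)) \<le> 1 / ?p"
    using k vabs_diff_le[of "z ^ ?p - of_nat k" "z - of_nat k"] by simp
  then show ?thesis by simp
qed

lemma padic_fermat_iter:
  assumes z: "vabs (z :: 'p::prime_card padic) \<le> 1"
  shows "vabs (z ^ (CARD('p) ^ k) - z) \<le> 1 / CARD('p)"
proof (induction k)
  case 0
  then show ?case by simp
next
  case (Suc k)
  let ?w = "z ^ (CARD('p) ^ k)"
  have "vabs (?w ^ CARD('p) - ?w) \<le> 1 / CARD('p)"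
    using padic_fermat[OF vabs_power_le_1[OF z]] .
  then have "vabs ((?w ^ CARD('p) - ?w) + (?w - z)) \<le> 1 / CARD('p)"
    using Suc.IH vabs_add[of "?w ^ CARD('p) - ?w" "?w - z"] by linarith
  then show ?case by (simp add: power_mult[symmetric] mult.commute)
qed

text \<open>The cofactor of \<open>z - w\<close> has \<open>p\<close> terms, all congruent to
  \<open>z ^ (p - 1)\<close> modulo \<open>p\<close>. Their sum is thus congruent to
  \<open>p * z ^ (p - 1)\<close>, hence to 0.\<close>

lemma padic_power_CARD_contract:
  fixes z w :: "'p::prime_card padic"
  assumes z: "vabs z \<le> 1" and w: "vabs w \<le> 1" and zw: "vabs (z - w) \<le> 1 / CARD('p)"
  shows "vabs (z ^ CARD('p) - w ^ CARD('p)) \<le> vabs (z - w) / CARD('p)"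
proof -
  let ?p = "CARD('p)"
  have p: "?p > 0" using prime_gt_0_nat[OF prime_card[where 'a = 'p]] .
  have term_le: "vabs (w ^ (?p - Suc i) * z ^ i - z ^ (?p - 1)) \<le> 1 / ?p" if "i < ?p" for i
  proof -
    have "?p - 1 = (?p - Suc i) + i" using that by simp
    then have "w ^ (?p - Suc i) * z ^ i - z ^ (?p - 1) = (w ^ (?p - Suc i) - z ^ (?p - Suc i)) * z ^ i"
      by (metis power_add left_diff_distrib)
    moreover have "vabs (w ^ (?p - Suc i) - z ^ (?p - Suc i)) \<le> vabs (z - w)"
      using vabs_power_diff_le[OF w z] by (simp add: vabs_diff_commute)
    ultimately show ?thesis
      using zw vabs_power_le_1[OF z, of i] mult_mono[of _ "1 / ?p" "vabs (z ^ i)" 1]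
      by (simp add: vabs_mult vabs_nonneg)
  qed
  have "vabs (\<Sum>i<?p. w ^ (?p - Suc i) * z ^ i - z ^ (?p - 1)) \<le> 1 / ?p"
    using term_le by (intro vabs_sum_le) auto
  moreover have "vabs (of_nat ?p * z ^ (?p - 1)) \<le> 1 / ?p"
    using vabs_power_le_1[OF z, of "?p - 1"]
    by (simp add: vabs_mult vabs_of_nat_CARD divide_right_mono)
  ultimately have "vabs ((\<Sum>i<?p. w ^ (?p - Suc i) * z ^ i - z ^ (?p - 1)) + of_nat ?p * z ^ (?p - 1)) \<le> 1 / ?p"
    using vabs_add[of "\<Sum>i<?p. w ^ (?p - Suc i) * z ^ i - z ^ (?p - 1)" "of_nat ?p * z ^ (?p - 1)"]
    by linarith
  then have "vabs (\<Sum>i<?p. w ^ (?p - Suc i) * z ^ i) \<le> 1 / ?p"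
    by (simp add: sum_subtractf)
  then have "vabs (z - w) * vabs (\<Sum>i<?p. w ^ (?p - Suc i) * z ^ i) \<le> vabs (z - w) * (1 / ?p)"
    by (intro mult_left_mono vabs_nonneg)
  then show ?thesis by (simp add: power_diff_sumr2 vabs_mult)
qed

text \<open>The first \<open>k - 1\<close> powers by \<open>p\<close> do not increase the distance,
  and the last one contributes the factor \<open>1 / p\<close>.\<close>

lemma padic_power_CARD_power_contract:
  fixes z w :: "'p::prime_card padic"
  assumes z: "vabs z \<le> 1" and w: "vabs w \<le> 1" and zw: "vabs (z - w) \<le> 1 / CARD('p)"
    and "k \<ge> 1"
  shows "vabs (z ^ (CARD('p) ^ k) - w ^ (CARD('p) ^ k)) \<le> vabs (z - w) / CARD('p)"
proof -
  let ?p = "CARD('p)"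
  obtain j where k: "k = Suc j" using \<open>k \<ge> 1\<close> by (cases k) auto
  have le: "vabs (z ^ (?p ^ j) - w ^ (?p ^ j)) \<le> vabs (z - w)"
    by (rule vabs_power_diff_le[OF z w])
  have "vabs ((z ^ (?p ^ j)) ^ ?p - (w ^ (?p ^ j)) ^ ?p) \<le> vabs (z ^ (?p ^ j) - w ^ (?p ^ j)) / ?p"
    using le zw by (intro padic_power_CARD_contract vabs_power_le_1 z w) linarith
  also have "\<dots> \<le> vabs (z - w) / ?p" using le by (intro divide_right_mono) auto
  finally show ?thesis by (simp add: k power_mult[symmetric] mult.commute)
qed


section \<open>The map on the affine line\<close>

definition phi_num :: "'p::prime_card padic \<Rightarrow> 'p padic" where
  "phi_num z = z ^ CARD('p) - z"

definition phi_den :: "nat \<Rightarrow> nat \<Rightarrow> 'p::prime_card padic \<Rightarrow> 'p padic" where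
  "phi_den m n z = of_nat CARD('p) + z ^ (CARD('p) ^ m) - z ^ (CARD('p) ^ n)"

text \<open>\<open>phi_den_nonzero\<close> shows that the division is genuine at every point when
  \<open>1 \<le> n < m\<close>, so this is the full affine part of the map, without poles.\<close>

definition phi :: "nat \<Rightarrow> nat \<Rightarrow> 'p::prime_card padic \<Rightarrow> 'p padic" where
  "phi m n z = phi_num z / phi_den m n z"

definition phi_num_poly :: "'p::prime_card padic poly" where
  "phi_num_poly = [:0, 1:] ^ CARD('p) - [:0, 1:]"

definition phi_den_poly :: "nat \<Rightarrow> nat \<Rightarrow> 'p::prime_card padic poly" where
  "phi_den_poly m n = of_nat CARD('p) + [:0, 1:] ^ (CARD('p) ^ m) - [:0, 1:] ^ (CARD('p) ^ n)"

lemma poly_phi_num_poly: "poly phi_num_poly z = phi_num z"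
  by (simp add: phi_num_poly_def phi_num_def)

lemma poly_phi_den_poly: "poly (phi_den_poly m n) z = phi_den m n z"
  by (simp add: phi_den_poly_def phi_den_def)

lemma coeff_X_power: "coeff ([:0, 1:] ^ k) i = (if i = k then 1 else 0 :: 'a::comm_semiring_1)"
proof -
  have "[:0, 1:] ^ k = monom (1 :: 'a) k" by (simp add: monom_altdef)
  then show ?thesis by auto
qed

lemma phi_num_poly_nonzero: "(phi_num_poly :: 'p::prime_card padic poly) \<noteq> 0"
proof -
  have "coeff (phi_num_poly :: 'p padic poly) CARD('p) = 1"
    using one_less_CARD[where 'a = 'p] coeff_X_power[of 1 "CARD('p)", where 'a = "'p padic"]
    by (simp add: phi_num_poly_def coeff_X_power)
  then show ?thesis by auto
qed

lemma degree_phi_num_poly: "degree (phi_num_poly :: 'p::prime_card padic poly) \<le> CARD('p)"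
  using one_less_CARD[where 'a = 'p] unfolding phi_num_poly_def
  by (intro degree_diff_le) (auto simp: degree_power_eq)

context
  fixes m n :: nat
  assumes n1: "1 \<le> n" and nm: "n < m"
begin

section \<open>Size of the denominator and of the values of \<open>phi\<close>\<close>

lemma CARD_less_powers:
  "CARD('p::prime_card) < CARD('p) ^ m" "CARD('p) ^ n < CARD('p) ^ m"
proof -
  have p1: "1 < CARD('p)" by (rule one_less_CARD)
  show "CARD('p) ^ n < CARD('p) ^ m" using p1 nm by simp
  have "CARD('p) ^ 1 < CARD('p) ^ m" using p1 n1 nm by (subst power_strict_increasing_iff) auto
  then show "CARD('p) < CARD('p) ^ m" by simp
qed

text \<open>The two powers of \<open>z\<close> are the \<open>p ^ n\<close>-th powers of
  \<open>z ^ (p ^ (m - n))\<close> and of \<open>z\<close>, which are congruent modulo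
  \<open>p\<close> by Fermat. As \<open>n \<ge> 1\<close>, their difference is at most
  \<open>1 / p ^ 2\<close> and the constant term \<open>p\<close> dominates.\<close>

lemma vabs_phi_den_integral:
  assumes z: "vabs (z :: 'p::prime_card padic) \<le> 1"
  shows "vabs (phi_den m n z) = 1 / CARD('p)"
proof -
  let ?p = "CARD('p)"
  have p1: "real ?p > 1" using one_less_CARD[where 'a = 'p] by simp
  let ?w = "z ^ (?p ^ (m - n))"
  have w: "vabs (?w - z) \<le> 1 / ?p" by (rule padic_fermat_iter[OF z])
  have "?w ^ (?p ^ n) = z ^ (?p ^ m)" using nm by (simp flip: power_mult power_add)
  then have "vabs (z ^ (?p ^ m) - z ^ (?p ^ n)) \<le> vabs (?w - z) / ?p"
    using padic_power_CARD_power_contract[OF vabs_power_le_1[OF z] z w n1] by simp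
  also have "\<dots> \<le> (1 / ?p) / ?p" using w by (intro divide_right_mono) auto
  also have "\<dots> < 1 / ?p" using p1 by (simp add: field_simps)
  finally have "vabs (of_nat ?p + (z ^ (?p ^ m) - z ^ (?p ^ n))) = 1 / ?p"
    by (subst vabs_add_dominant) (simp_all add: vabs_of_nat_CARD)
  then show ?thesis by (simp add: phi_den_def algebra_simps)
qed

lemma vabs_phi_den_large:
  assumes z: "vabs (z :: 'p::prime_card padic) > 1"
  shows "vabs (phi_den m n z) = vabs z ^ (CARD('p) ^ m)"
proof -
  let ?p = "CARD('p)"
  note p = one_less_CARD[where 'a = 'p] CARD_less_powers[where 'p = 'p]
  have "vabs z ^ (?p ^ n) < vabs z ^ (?p ^ m)" using z p by simp
  moreover have "vabs z ^ 0 < vabs z ^ (?p ^ m)" using z p by (subst power_strict_increasing_iff) auto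
  then have "vabs (of_nat ?p :: 'p padic) < vabs z ^ (?p ^ m)"
    using vabs_of_nat_le_1[of ?p, where 'p = 'p] by simp
  ultimately have "vabs (of_nat ?p - z ^ (?p ^ n)) < vabs (z ^ (?p ^ m))"
    using vabs_diff_le[of "of_nat ?p" "z ^ (?p ^ n)"] by (simp add: vabs_power)
  from vabs_add_dominant[OF this] show ?thesis
    by (simp add: phi_den_def vabs_power algebra_simps)
qed

lemma phi_den_nonzero: "phi_den m n (z :: 'p::prime_card padic) \<noteq> 0"
proof -
  have "vabs (phi_den m n z) > 0"
    using vabs_phi_den_integral[of z] vabs_phi_den_large[of z] one_less_CARD[where 'a = 'p]
    by (cases "vabs z \<le> 1") auto
  then show ?thesis by (simp add: vabs_pos_iff)
qed

text \<open>On the unit ball the Fermat bound on the numerator equals the exact size of the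
  denominator; outside it the degree \<open>p ^ m\<close> of the denominator wins.\<close>

lemma vabs_phi_le_1: "vabs (phi m n (z :: 'p::prime_card padic)) \<le> 1"
proof -
  let ?p = "CARD('p)"
  have den: "vabs (phi_den m n z) > 0" by (simp add: vabs_pos_iff phi_den_nonzero)
  have "vabs (phi_num z) \<le> vabs (phi_den m n z)"
  proof (cases "vabs z \<le> 1")
    case True
    then show ?thesis unfolding phi_num_def using padic_fermat vabs_phi_den_integral by metis
  next
    case False
    note p = one_less_CARD[where 'a = 'p] CARD_less_powers[where 'p = 'p]
    have "vabs (phi_num z) \<le> max (vabs z ^ ?p) (vabs z ^ 1)"
      using vabs_diff_le[of "z ^ ?p" z] by (simp add: phi_num_def vabs_power)
    also have "\<dots> \<le> vabs z ^ (?p ^ m)"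
      using False p by (intro max.boundedI power_increasing) auto
    finally show ?thesis using False by (simp add: vabs_phi_den_large)
  qed
  then show ?thesis using den by (simp add: phi_def vabs_divide)
qed

text \<open>
  Both \<open>z ^ p\<close> and the denominator vary by at most \<open>\<bar>z - w\<bar> / p\<close>, so that the linear term of
  the numerator dominates the difference.
\<close>

lemma phi_expanding:
  fixes z w :: "'p::prime_card padic"
  assumes z: "vabs z \<le> 1" and w: "vabs w \<le> 1" and zw: "vabs (z - w) < 1"
  shows "vabs (phi m n z - phi m n w) = CARD('p) * vabs (z - w)"
proof (cases "z = w")
  case False
  let ?p = "CARD('p)"
  let ?N = "phi_num :: 'p padic \<Rightarrow> 'p padic" and ?D = "phi_den m n :: 'p padic \<Rightarrow> 'p padic"
  have p1: "real ?p > 1" using one_less_CARD[where 'a = 'p] by simp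
  have pos: "vabs (z - w) > 0" using False by (simp add: vabs_pos_iff)
  have less: "vabs (z - w) / ?p < vabs (z - w)" using pos p1 by (simp add: field_simps)
  \<comment> \<open>Discreteness upgrades the strict bound by 1 to the bound \<open>1 / p\<close>
    required for contraction.\<close>
  have le: "vabs (z - w) \<le> 1 / ?p" by (rule padic_vabs_lt_1[OF zw])
  have contract: "vabs (z ^ (?p ^ k) - w ^ (?p ^ k)) \<le> vabs (z - w) / ?p" if "k \<ge> 1" for k
    by (rule padic_power_CARD_power_contract[OF z w le that])
  have "vabs (z ^ ?p - w ^ ?p) < vabs (z - w)"
    using contract[of 1] less by simp
  then have "vabs ((z - w) - (z ^ ?p - w ^ ?p)) = vabs (z - w)"
    by (rule vabs_diff_dominant)
  moreover have "(z - w) - (z ^ ?p - w ^ ?p) = ?N w - ?N z" by (simp add: phi_num_def)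
  ultimately have N: "vabs (?N z - ?N w) = vabs (z - w)" by (simp add: vabs_diff_commute)
  have "?D z - ?D w = (z ^ (?p ^ m) - w ^ (?p ^ m)) - (z ^ (?p ^ n) - w ^ (?p ^ n))"
    by (simp add: phi_den_def)
  then have "vabs (?D z - ?D w) \<le> vabs (z - w) / ?p"
    using vabs_diff_le[of "z ^ (?p ^ m) - w ^ (?p ^ m)" "z ^ (?p ^ n) - w ^ (?p ^ n)"]
      contract[of m] contract[of n] n1 nm by simp
  then have D: "vabs (?D z - ?D w) < vabs (z - w)" using less by linarith
  have Nw: "vabs (?N w) \<le> 1 / ?p" using padic_fermat[OF w] by (simp add: phi_num_def)
  \<comment> \<open>The difference of the two quotients is
    \<open>(?N z - ?N w) * ?D w - ?N w * (?D z - ?D w)\<close> over \<open>?D z * ?D w\<close>. The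
    first product, of size \<open>vabs (z - w) / p\<close>, dominates; dividing by a denominator of
    size \<open>1 / p ^ 2\<close> yields the factor \<open>p\<close>.\<close>
  have "vabs (?N w * (?D z - ?D w)) \<le> (1 / ?p) * vabs (?D z - ?D w)"
    unfolding vabs_mult using Nw by (intro mult_right_mono vabs_nonneg)
  also have "\<dots> < vabs ((?N z - ?N w) * ?D w)"
    using D p1 by (simp add: vabs_mult N vabs_phi_den_integral[OF w] divide_strict_right_mono)
  finally have "vabs ((?N z - ?N w) * ?D w - ?N w * (?D z - ?D w)) = vabs (z - w) / ?p"
    by (subst vabs_diff_dominant) (simp_all add: vabs_mult N vabs_phi_den_integral[OF w])
  moreover have "phi m n z - phi m n w = ((?N z - ?N w) * ?D w - ?N w * (?D z - ?D w)) / (?D z * ?D w)"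
    by (simp add: phi_def phi_den_nonzero field_simps)
  ultimately show ?thesis
    using p1 by (simp add: vabs_divide vabs_mult vabs_phi_den_integral z w)
qed simp

section \<open>Iteration on the unit ball\<close>

lemma vabs_phi_iter_le_1: "vabs (z :: 'p::prime_card padic) \<le> 1 \<Longrightarrow> vabs ((phi m n ^^ k) z) \<le> 1"
  by (cases k) (simp_all add: vabs_phi_le_1)

text \<open>Distances in the unit ball never exceed 1. If 1 were never attained,
  \<open>phi_expanding\<close> would apply at every step and the distance would grow like
  \<open>p ^ k\<close>.\<close>

lemma phi_iter_separates:
  fixes z w :: "'p::prime_card padic"
  assumes z: "vabs z \<le> 1" and w: "vabs w \<le> 1" and "z \<noteq> w"
  shows "\<exists>k. vabs ((phi m n ^^ k) z - (phi m n ^^ k) w) = 1"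
proof (rule ccontr)
  assume no: "\<not> ?thesis"
  have lt: "vabs ((phi m n ^^ k) z - (phi m n ^^ k) w) < 1" for k
  proof -
    have "max (vabs ((phi m n ^^ k) z)) (vabs ((phi m n ^^ k) w)) \<le> 1"
      using vabs_phi_iter_le_1[OF z] vabs_phi_iter_le_1[OF w] by simp
    then have "vabs ((phi m n ^^ k) z - (phi m n ^^ k) w) \<le> 1"
      using vabs_diff_le order.trans by blast
    moreover have "vabs ((phi m n ^^ k) z - (phi m n ^^ k) w) \<noteq> 1" using no by blast
    ultimately show ?thesis by linarith
  qed
  have grow: "vabs ((phi m n ^^ k) z - (phi m n ^^ k) w) = CARD('p) ^ k * vabs (z - w)" for k
  proof (induction k)
    case (Suc k)
    then show ?case
      using phi_expanding[OF vabs_phi_iter_le_1[OF z] vabs_phi_iter_le_1[OF w] lt, of k] by simp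
  qed simp
  have pos: "vabs (z - w) > 0" using \<open>z \<noteq> w\<close> by (simp add: vabs_pos_iff)
  obtain k where "1 / vabs (z - w) < real CARD('p) ^ k"
    using real_arch_pow[of "real CARD('p)"] one_less_CARD[where 'a = 'p] by auto
  then have "1 < real CARD('p) ^ k * vabs (z - w)" using pos by (simp add: field_simps)
  then show False using lt[of k] grow[of k] by simp
qed

section \<open>Degrees and finite fibres\<close>

lemma coeff_phi_den_poly: "coeff (phi_den_poly m n :: 'p::prime_card padic poly) (CARD('p) ^ m) = 1"
  using one_less_CARD[where 'a = 'p] CARD_less_powers[where 'p = 'p]
  by (simp add: phi_den_poly_def coeff_X_power of_nat_poly coeff_pCons split: nat.split)

lemma degree_phi_num_less_den:
  "degree (phi_num_poly :: 'p::prime_card padic poly) < degree (phi_den_poly m n :: 'p padic poly)"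
proof -
  have "CARD('p) ^ m \<le> degree (phi_den_poly m n :: 'p padic poly)"
    by (rule le_degree) (simp add: coeff_phi_den_poly)
  then show ?thesis using degree_phi_num_poly[where 'p = 'p] CARD_less_powers(1)[where 'p = 'p] by linarith
qed

text \<open>The fibre of \<open>phi\<close> through \<open>z\<close> is the zero set of a nonzero
  polynomial, hence finite, while the points \<open>z + p ^ k\<close> are infinitely many and tend
  to \<open>z\<close>.\<close>

lemma phi_nonconstant:
  fixes z :: "'p::prime_card padic"
  assumes "d > 0"
  shows "\<exists>w. vabs (z - w) < d \<and> phi m n w \<noteq> phi m n z"
proof -
  let ?p = "CARD('p)"
  define c where "c = phi m n z"
  define f where "f = (phi_num_poly :: 'p padic poly) - Polynomial.smult c (phi_den_poly m n)"
  \<comment> \<open>For \<open>c = 0\<close> the polynomial is the numerator itself. Otherwise its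
    coefficient at \<open>p ^ m\<close>, beyond the degree of the numerator, is
    \<open>- c\<close>.\<close>
  have "f \<noteq> 0"
  proof (cases "c = 0")
    case False
    have "coeff (phi_num_poly :: 'p padic poly) (?p ^ m) = 0"
      using degree_phi_num_poly[where 'p = 'p] CARD_less_powers(1)[where 'p = 'p]
      by (intro coeff_eq_0) linarith
    then have "coeff f (?p ^ m) = - c" by (simp add: f_def coeff_phi_den_poly)
    then show ?thesis using False by auto
  qed (simp add: f_def phi_num_poly_nonzero)
  then have fin: "finite {w. poly f w = 0}" by (rule poly_roots_finite)
  have p1: "real ?p > 1" using one_less_CARD[where 'a = 'p] by simp
  obtain K where K: "(1 / real ?p) ^ K < d"
    using real_arch_pow_inv[OF assms, of "1 / real ?p"] p1 by auto
  let ?u = "\<lambda>k. z + of_nat ?p ^ k"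
  have vabs_u: "vabs (of_nat ?p ^ k :: 'p padic) = (1 / real ?p) ^ k" for k
    by (simp add: vabs_power vabs_of_nat_CARD)
  have "inj ?u"
  proof (rule injI)
    fix i j assume "?u i = ?u j"
    then have "vabs (of_nat ?p ^ i :: 'p padic) = vabs (of_nat ?p ^ j :: 'p padic)" by simp
    then have "real ?p ^ i = real ?p ^ j" unfolding vabs_u by (simp add: power_one_over)
    then show "i = j" using p1 by (simp add: power_inject_exp)
  qed
  then have "infinite (?u ` {K..})"
    by (metis finite_imageD infinite_Ici inj_on_subset subset_UNIV)
  then have "\<not> ?u ` {K..} \<subseteq> {w. poly f w = 0}" using fin finite_subset by blast
  then obtain k where k: "k \<ge> K" "poly f (?u k) \<noteq> 0" by blast
  have "phi m n (?u k) \<noteq> c"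
    using k(2) by (auto simp: f_def poly_phi_num_poly poly_phi_den_poly phi_def phi_den_nonzero)
  moreover have "vabs (z - ?u k) = (1 / real ?p) ^ k" by (simp add: vabs_u del: of_nat_power)
  moreover have "(1 / real ?p) ^ k \<le> (1 / real ?p) ^ K"
    using k(1) p1 by (intro power_decreasing) auto
  ultimately show ?thesis unfolding c_def using K by (metis le_less_trans)
qed

end

section \<open>Rational maps on the projective line\<close>

definition affine_pt :: "'a::field \<Rightarrow> 'a proj_line" where
  "affine_pt z = abs_proj_line (z, 1)"

definition infinity_pt :: "'a::field proj_line" where
  "infinity_pt = abs_proj_line (1, 0)"

lemma abs_proj_line_eqI:
  assumes "(a, b) \<noteq> (0, 0)" "(c, d) \<noteq> (0, 0)" "a * d = c * b"
  shows "abs_proj_line (a, b) = abs_proj_line (c, d)"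
  using assms by (intro Quotient_rel_abs[OF Quotient_proj_line]) (simp add: proj_rel_iff)

lemma proj_line_cases:
  obtains z where "P = affine_pt z" | "P = infinity_pt"
proof -
  have "(\<exists>z. P = affine_pt z) \<or> P = infinity_pt"
  proof (induction P rule: proj_line.abs_induct)
    case (1 y)
    obtain a b where y: "y = (a, b)" by force
    have nz: "(a, b) \<noteq> (0, 0)" using 1 by (simp add: y proj_rel_refl)
    show ?case
    proof (cases "b = 0")
      case True
      then show ?thesis using nz by (auto simp: y infinity_pt_def intro!: abs_proj_line_eqI)
    next
      case False
      then have "abs_proj_line y = affine_pt (a / b)"
        unfolding y affine_pt_def using nz by (intro abs_proj_line_eqI) auto
      then show ?thesis by blast
    qed
  qed
  then show ?thesis using that by blast
qed

lemma dist_affine_pt: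
  "dist (affine_pt z) (affine_pt w) = vabs (z - w) / (max (vabs z) 1 * max (vabs w) 1)"
  by (simp add: affine_pt_def dist_proj_line.abs_eq proj_rel_refl spherical_def)

lemma dist_affine_pt_le: "dist (affine_pt z) (affine_pt w) \<le> vabs (z - w)"
proof -
  have "1 * 1 \<le> max (vabs z) 1 * max (vabs w) 1" by (intro mult_mono) auto
  then have "vabs (z - w) / (max (vabs z) 1 * max (vabs w) 1) \<le> vabs (z - w) / 1"
    using vabs_nonneg[of "z - w"] by (intro divide_left_mono) auto
  then show ?thesis by (simp add: dist_affine_pt)
qed

lemma dist_infinity_affine_pt: "dist infinity_pt (affine_pt w) = 1 / max (vabs w) 1"
  by (simp add: infinity_pt_def affine_pt_def dist_proj_line.abs_eq proj_rel_refl spherical_def)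

section \<open>The map induced by a fraction given by an arbitrary representation\<close>

context
  fixes r :: "'a::field_gcd poly fract" and N D :: "'a poly"
  assumes r: "r = Fraction_Field.Fract N D" and D: "D \<noteq> 0"
begin

text \<open>\<open>ratmap\<close> is defined through the reduced pair \<open>f\<close>,
  \<open>g\<close>. Cross multiplication carries what is known of \<open>N\<close> and
  \<open>D\<close> over to it, without computing a gcd.\<close>

lemma quot_of_fract_cross_mult:
  assumes "quot_of_fract r = (f, g)"
  shows "f * D = N * g" "coprime f g" "g \<noteq> 0"
proof -
  show g: "g \<noteq> 0" using snd_quot_of_fract_nonzero[of r] assms by simp
  have "Fraction_Field.Fract f g = r" using Fract_quot_of_fract[of r] unfolding assms by simp
  then show "f * D = N * g" using g D by (simp add: r eq_fract)
  show "coprime f g" using coprime_quot_of_fract[of r] assms by simp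
qed

lemma ratmap_affine_pt:
  assumes x: "poly D x \<noteq> 0"
  shows "ratmap r (affine_pt x) = affine_pt (poly N x / poly D x)"
proof -
  obtain f g where fg: "quot_of_fract r = (f, g)" by force
  define d where "d = max (degree f) (degree g)"
  have cross: "poly f x * poly D x = poly N x * poly g x"
    using quot_of_fract_cross_mult(1)[OF fg] by (metis poly_mult)
  have f: "hom_eval d f x 1 = poly f x" and g: "hom_eval d g x 1 = poly g x"
    by (simp_all add: hom_eval_nonzero d_def)
  have "(poly f x, poly g x) \<noteq> (0, 0)"
    using hom_eval_coprime[OF quot_of_fract_cross_mult(2)[OF fg] d_def, of x 1] f g by simp
  then have "abs_proj_line (poly f x, poly g x) = affine_pt (poly N x / poly D x)"
    unfolding affine_pt_def using cross x by (intro abs_proj_line_eqI) (auto simp: field_simps)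
  then show ?thesis
    by (simp add: affine_pt_def ratmap.abs_eq proj_rel_refl fg Let_def f g flip: d_def)
qed

text \<open>Cross multiplication preserves the degree difference, so
  \<open>degree f < degree g\<close> too, and at \<open>[1, 0]\<close> only the leading coefficient
  of \<open>g\<close> survives.\<close>

lemma ratmap_infinity_pt:
  assumes N: "N \<noteq> 0" and deg: "degree N < degree D"
  shows "ratmap r infinity_pt = affine_pt 0"
proof -
  obtain f g where fg: "quot_of_fract r = (f, g)" by force
  note cross = quot_of_fract_cross_mult[OF fg]
  have "f \<noteq> 0" using cross N by auto
  then have "degree f + degree D = degree N + degree g"
    using cross D N by (metis degree_mult_eq)
  then have less: "degree f < degree g" using deg by linarith
  then have "max (degree f) (degree g) = degree g" by simp
  moreover have "hom_eval (degree g) f 1 0 = 0" using less by (simp add: hom_eval_infinity coeff_eq_0)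
  moreover have "abs_proj_line (0, lead_coeff g) = affine_pt 0"
    unfolding affine_pt_def using cross(3) by (intro abs_proj_line_eqI) auto
  ultimately show ?thesis
    by (simp add: infinity_pt_def ratmap.abs_eq proj_rel_refl fg Let_def hom_eval_infinity)
qed

end

theorem corollary1p2:
  fixes p m n :: nat and \<phi> :: "'p::prime_card padic poly fract"
  assumes "p = CARD('p)" and "1 \<le> n" and "n < m"
    and "\<phi> = (indet ^ p - indet) / (of_nat p + indet ^ (p ^ m) - indet ^ (p ^ n))"
  shows "fatou_set (ratmap \<phi>) = {}"
proof (rule ccontr)
  note nm = assms(2,3)
  let ?N = "phi_num_poly :: 'p padic poly" and ?D = "phi_den_poly m n :: 'p padic poly"
  let ?R = "ratmap \<phi>" and ?F = "phi m n :: 'p padic \<Rightarrow> 'p padic"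
  \<comment> \<open>Moving \<open>to_fract\<close> outward through powers and numerals turns the
    given expression into a fraction of two explicit polynomials.\<close>
  have X: "indet = to_fract ([:0, 1:] :: 'p padic poly)" by (simp add: indet_def to_fract_def)
  have pow: "to_fract f ^ k = to_fract (f ^ k)" for f :: "'p padic poly" and k
    by (induction k) simp_all
  have nat: "of_nat k = to_fract (of_nat k :: 'p padic poly)" for k
    by (induction k) simp_all
  have \<phi>: "\<phi> = Fraction_Field.Fract ?N ?D"
    unfolding assms(4) assms(1) X pow nat Fract_conv_to_fract
    by (simp add: phi_num_poly_def phi_den_poly_def)
  have D: "?D \<noteq> 0" using degree_phi_num_less_den[OF nm] by (metis degree_0 less_zeroE)
  have affine: "?R (affine_pt z) = affine_pt (?F z)" for z
    using ratmap_affine_pt[OF \<phi> D, of z]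
    by (simp add: poly_phi_num_poly poly_phi_den_poly phi_den_nonzero[OF nm] phi_def)
  have infinity: "?R infinity_pt = affine_pt 0"
    by (rule ratmap_infinity_pt[OF \<phi> D phi_num_poly_nonzero degree_phi_num_less_den[OF nm]])
  have iter: "(?R ^^ k) (affine_pt z) = affine_pt ((?F ^^ k) z)" for k z
    by (induction k) (simp_all add: affine)
  assume "fatou_set ?R \<noteq> {}"
  then obtain P U where PU: "open U" "P \<in> U" "equicontinuous_on U (range (\<lambda>k. ?R ^^ k))"
    by (auto simp: fatou_set_def)
  obtain d1 where d1: "d1 > 0" "\<And>Q. dist Q P < d1 \<Longrightarrow> Q \<in> U"
    using PU(1,2) unfolding open_dist by blast
  obtain d2 where d2: "d2 > 0"
    \<comment> \<open>Equicontinuity is used at \<open>P\<close> only, with tolerance 1, the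
      distance that separated orbits attain.\<close>
    "\<And>Q k. Q \<in> U \<Longrightarrow> dist P Q < d2 \<Longrightarrow> dist ((?R ^^ k) P) ((?R ^^ k) Q) < 1"
    using PU(2,3) unfolding equicontinuous_on_def by (metis rangeI zero_less_one)
  define d where "d = min d1 d2"
  have "d > 0" using d1 d2 by (simp add: d_def)
  have close: "dist ((?R ^^ k) P) ((?R ^^ k) Q) < 1" if "dist P Q < d" for Q k
    using that d1(2)[of Q] d2(2)[of Q k] by (simp add: d_def dist_commute)
  \<comment> \<open>One application of the map brings \<open>P\<close> and a suitable neighbour into
    the unit ball as distinct points, where \<open>phi_iter_separates\<close> takes over.\<close>
  have "\<exists>Q a b. dist P Q < d \<and> ?R P = affine_pt a \<and> ?R Q = affine_pt b \<and>
    vabs a \<le> 1 \<and> vabs b \<le> 1 \<and> a \<noteq> b"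
  proof (cases P rule: proj_line_cases)
    case (1 z)
    obtain w where w: "vabs (z - w) < d" "?F w \<noteq> ?F z"
      using phi_nonconstant[OF nm \<open>d > 0\<close>] by blast
    have "dist P (affine_pt w) < d" using dist_affine_pt_le[of z w] w(1) 1 by simp
    then show ?thesis using w(2) 1 affine vabs_phi_le_1[OF nm] by metis
  next
    case 2
    have p1: "real CARD('p) > 1" using one_less_CARD[where 'a = 'p] by simp
    obtain k where k: "1 / d < real CARD('p) ^ k" using real_arch_pow[OF p1] by blast
    \<comment> \<open>A point of absolute value above \<open>1 / d\<close> is within
      \<open>d\<close> of infinity. The exponent \<open>Suc k\<close> ensures
      \<open>vabs w > 1\<close> even for \<open>k = 0\<close>, which makes the numerator nonzero and
      so separates the image of \<open>w\<close> from \<open>affine_pt 0\<close>, the image of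
      infinity.\<close>
    define w :: "'p padic" where "w = 1 / of_nat CARD('p) ^ Suc k"
    have vw: "vabs w = real CARD('p) ^ Suc k"
      by (simp add: w_def vabs_divide vabs_power vabs_mult vabs_of_nat_CARD power_one_over)
    have "real CARD('p) ^ k \<le> vabs w" unfolding vw using p1 by (intro power_increasing) auto
    then have "1 / d < vabs w" using k by linarith
    moreover have gt: "vabs w > 1" unfolding vw using p1 by (intro one_less_power) auto
    ultimately have "dist P (affine_pt w) < d"
      using \<open>d > 0\<close> 2 by (simp add: dist_infinity_affine_pt field_simps)
    moreover have "?F w \<noteq> 0"
    proof -
      have "vabs w ^ 1 < vabs w ^ CARD('p)"
        using gt p1 by (subst power_strict_increasing_iff) auto
      then have "w ^ CARD('p) \<noteq> w" by (metis less_irrefl power_one_right vabs_power)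
      then show ?thesis by (simp add: phi_def phi_num_def phi_den_nonzero[OF nm])
    qed
    ultimately show ?thesis using 2 affine infinity vabs_phi_le_1[OF nm, of w] by (metis vabs_0 zero_le_one)
  qed
  then obtain Q a b where Q: "dist P Q < d" "?R P = affine_pt a" "?R Q = affine_pt b"
    "vabs a \<le> 1" "vabs b \<le> 1" "a \<noteq> b" by blast
  obtain k where k: "vabs ((?F ^^ k) a - (?F ^^ k) b) = 1"
    using phi_iter_separates[OF nm Q(4-6)] by blast
  \<comment> \<open>The extra iterate is the initial step into the unit ball; there both maxima in
    \<open>dist_affine_pt\<close> are 1, so spherical and \<open>p\<close>-adic distances
    agree.\<close>
  have "dist ((?R ^^ Suc k) P) ((?R ^^ Suc k) Q) = 1"
    using k vabs_phi_iter_le_1[OF nm Q(4), of k] vabs_phi_iter_le_1[OF nm Q(5), of k]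
    by (simp add: funpow_Suc_right Q(2,3) iter dist_affine_pt max_absorb2 del: funpow.simps)
  then show False using close[OF Q(1), of "Suc k"] by simp
qed

end
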